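(* Let $T$ be an invertible block TBT-matrix which satisfies $$U_3\,t_j^{(r)}\,U_3=(t_j^{(r)})^{\tau}\quad\text{for all } r,j$$ (i.e. $T$ belongs to the DSTU subclass). Let $u_p,\widehat u_p$ $(p=1,2)$, $G_{12}$, $G_{21}$, $q$ and $\widetilde U_k$ be as in the context. Then $$u_p(\mu)=-q(\mu)\,U_3\,\widehat u_p(\mu)^{\tau}\,\widetilde U_k\qquad(k,p\in\{1,2\},\ k\neq p)$$ for all $\mu=(\mu_1,\mu_2)\in\mathbb C^2$ with $\mu_1,\mu_2\notin\{\mathrm i/2,-\mathrm i/2\}$. Moreover, $$G_{21}=\widetilde U_1\,G_{12}^{\tau}\,\widetilde U_2 .$$
   Context: Notation: $I_r$ is the $r\times r$ identity, $I=I_m$; $\otimes$ is the Kronecker product; ${}^*$ is the conjugate transpose and ${}^\tau$ the (non-conjugate) transpose; $\mathrm{col}[\dots]$ stacks blocks into a (block) column; $\mathbf 1_r$ is the $r\times1$ column of ones. Fix integers $m_1,m_2,m_3\ge2$ and put $m=m_1m_2m_3$. A block TBT-matrix is an $m\times m$ matrix $T=\{\mathcal T_{i-k}\}_{i,k=1}^{m_1}$, where $\mathcal T_r=\{t^{(r)}_{i-k}\}_{i,k=1}^{m_2}$ and the $t^{(r)}_s$ are complex $m_3\times m_3$ blocks. Let $U_p=\{\delta_{m_p-i-k+1}\}_{i,k=1}^{m_p}$ $(p=1,2,3)$, $\delta_s$ being the Kronecker delta ($\delta_0=1$, $\delta_s=0$ for $s\ne0$), so $U_p$ has ones on the antidiagonal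 and zeros elsewhere. For $k=1,2$ let $$\widetilde U_k=\begin{bmatrix}0&-U_k\otimes U_3 \\ U_k\otimes U_3&0\end{bmatrix},\qquad q(\mu)=\left(\frac{\mu_1-\frac{\mathrm i}2}{\mu_1+\frac{\mathrm i}2}\right)^{m_1}\left(\frac{\mu_2-\frac{\mathrm i}2}{\mu_2+\frac{\mathrm i}2}\right)^{m_2}.$$ Let $\mathcal A_p=\{a_{j-\ell}\}_{j,\ell=1}^{m_p}$ with $a_r=0$ for $r<0$, $a_0=\mathrm i/2$, $a_r=\mathrm i$ for $r>0$, and $A_1=\mathcal A_1\otimes I_{m_2}\otimes I_{m_3}$, $A_2=I_{m_1}\otimes\mathcal A_2\otimes I_{m_3}$ (these commute). Let $\mathcal L=\mathbf 1_{m_1m_2}\otimes I_{m_3}$ and $\mathcal L_p=\mathbf 1_{m_p}\otimes I_{m_3}$ $(p=1,2)$. Define $M_{11}=\mathrm{col}[M_{11}^{(1)},\dots,M_{11}^{(m_1)}]$, $M_{11}^{(i)}=\tfrac12\mathcal T_0+\sum_{s=1}^{i-1}\mathcal T_s$; $M_{21}=\mathbf 1_{m_1}^*\otimes I_{m_2m_3}$; $M_{31}=M_{21}^*$; $M_{41}=[M_{41}^{(1)}\ \dots\ M_{41}^{(m_1)}]$, $M_{41}^{(k)}=\tfrac12\mathcal T_0+\sum_{s=1}^{k-1}\mathcal T_{-s}$; $M_{12}=\{M_{12}^{(i-k)}\}_{i,k=1}^{m_1}$, where $M_{12}^{(r)}$ is the block column with $i$-th block $\tfrac12t_0^{(r)}+\sum_{j=1}^{i-1}t_j^{(r)}$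 $(1\le i\le m_2)$; $M_{22}=I_{m_1}\otimes\mathbf 1_{m_2}^*\otimes I_{m_3}$; $M_{32}=M_{22}^*$; $M_{42}=\{M_{42}^{(i-k)}\}_{i,k=1}^{m_1}$, where $M_{42}^{(r)}$ is the block row with $k$-th block $\tfrac12t_0^{(r)}+\sum_{\ell=1}^{k-1}t_{-\ell}^{(r)}$ $(1\le k\le m_2)$. For invertible $T$ and $p=1,2$ put $R=T^{-1}$, $\Pi_p=[M_{1p}\ M_{3p}]$, $\widehat\Pi_p=\begin{bmatrix}M_{2p} \\ M_{4p}\end{bmatrix}$, $\Gamma_p=R\Pi_p$, $\widehat\Gamma_p=\widehat\Pi_pR$. Define $$v_p(\mu)=\mathcal L^*\Big(\prod_{i=1}^2(A_i^*-\mu_iI)^{-1}\Big)\Gamma_p,\qquad \widehat v_p(\lambda)=\widehat\Gamma_p\Big(\prod_{i=1}^2(A_i-\lambda_iI)^{-1}\Big)\mathcal L,$$ and, for $\{k,p\}=\{1,2\}$, $$u_p(\mu)=v_p(\mu)-\mathrm i\big(\mathbf 1_{m_k}^*(\mathcal A_k^*-\mu_kI_{m_k})^{-1}\otimes I_{m_3}\big)\begin{bmatrix}I_{m_km_3}&0\end{bmatrix},$$ $$\widehat u_p(\lambda)=\widehat v_p(\lambda)+\mathrm i\begin{bmatrix}0 \\ I_{m_km_3}\end{bmatrix}\big((\mathcal A_k-\lambda_kI_{m_k})^{-1}\mathbf 1_{m_k}\otimes I_{m_3}\big),$$ where the zero blocks are square of order $m_km_3$. Define further $K_{11}$ = block column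 with $i$-th block $\tfrac12M_{42}^{(0)}+\sum_{j=1}^{i-1}M_{42}^{(j)}$ $(1\le i\le m_1)$; $K_{12}$ = block row with $k$-th block $\tfrac12M_{12}^{(0)}+\sum_{j=1}^{k-1}M_{12}^{(-j)}$ $(1\le k\le m_1)$; $$G_{21}=\mathrm i\left(\widehat\Pi_2\Gamma_1-\begin{bmatrix}\mathcal L_1\mathcal L_2^*&0 \\ K_{11}&0\end{bmatrix}\right),\qquad G_{12}=\mathrm i\left(\widehat\Pi_1\Gamma_2-\begin{bmatrix}\mathcal L_2\mathcal L_1^*&0 \\ K_{12}&0\end{bmatrix}\right).$$ These are the constant off-diagonal blocks of the matrix function $G(\lambda)=\begin{bmatrix}G_{11}(\lambda_2)&G_{12} \\ G_{21}&G_{22}(\lambda_1)\end{bmatrix}$ whose diagonal blocks are $G_{11}(\lambda_2)=I_2\otimes(\mathcal A_2-\lambda_2I_{m_2})\otimes I_{m_3}$ and $G_{22}(\lambda_1)=I_2\otimes(\mathcal A_1-\lambda_1I_{m_1})\otimes I_{m_3}$. *)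

theory Defs
  imports
    "Jordan_Normal_Form.Gauss_Jordan_Elimination"
    "Jordan_Normal_Form.Schur_Decomposition"
begin

text \<open>
  The sizes are given by a function \<open>m\<close> with values \<open>m 1\<close>, \<open>m 2\<close>, \<open>m 3\<close>, and a point of
  $\mathbb{C}^2$ by a function \<open>\<mu>\<close> with values \<open>\<mu> 1\<close>, \<open>\<mu> 2\<close>; other values of these functions are
  never used.  The block $t^{(r)}_j$ is \<open>t r j\<close>.  Whenever an index \<open>p\<close> ranges over $\{1,2\}$,
  the \<open>else\<close> branch of a definition stands for \<open>p = 2\<close>.
\<close>

text \<open>Library matrices are indexed from 0; the index functions below are applied to
  indices starting from 1, so that formulas can be copied literally.\<close>

definition mat1 :: "nat \<Rightarrow> nat \<Rightarrow> (int \<Rightarrow> int \<Rightarrow> complex) \<Rightarrow> complex mat" where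
  "mat1 nr nc f = mat nr nc (\<lambda>(i, k). f (int i + 1) (int k + 1))"

text \<open>The \<open>bi\<close> by \<open>bk\<close> block matrix with blocks \<open>F i k\<close> of size \<open>nr\<close> by \<open>nc\<close>.\<close>

definition block_mat ::
  "nat \<Rightarrow> nat \<Rightarrow> nat \<Rightarrow> nat \<Rightarrow> (int \<Rightarrow> int \<Rightarrow> complex mat) \<Rightarrow> complex mat" where
  "block_mat bi bk nr nc F = mat (bi * nr) (bk * nc)
     (\<lambda>(x, y). F (int (x div nr) + 1) (int (y div nc) + 1) $$ (x mod nr, y mod nc))"

definition kron :: "complex mat \<Rightarrow> complex mat \<Rightarrow> complex mat" (infixl \<open>\<otimes>\<^sub>K\<close> 75) where
  "A \<otimes>\<^sub>K B = mat (dim_row A * dim_row B) (dim_col A * dim_col B)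
     (\<lambda>(x, y). A $$ (x div dim_row B, y div dim_col B) * B $$ (x mod dim_row B, y mod dim_col B))"

definition append_cols :: "complex mat \<Rightarrow> complex mat \<Rightarrow> complex mat" (infixr \<open>@\<^sub>c\<close> 65) where
  "A @\<^sub>c B = (A\<^sup>T @\<^sub>r B\<^sup>T)\<^sup>T"

text \<open>Only meaningful for invertible \<open>A\<close>.\<close>

definition mat_inv :: "complex mat \<Rightarrow> complex mat" where
  "mat_inv A = the (mat_inverse A)"

definition ones :: "nat \<Rightarrow> complex mat" where
  "ones r = mat r 1 (\<lambda>_. 1)"

definition half_sum :: "(int \<Rightarrow> complex mat) \<Rightarrow> int \<Rightarrow> complex mat" where
  "half_sum F i = mat (dim_row (F 0)) (dim_col (F 0))
     (\<lambda>ab. (1/2) * (F 0 $$ ab) + (\<Sum>s = 1..i - 1. F s $$ ab))"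

definition kdelta :: "int \<Rightarrow> complex" where
  "kdelta s = (if s = 0 then 1 else 0)"

definition U_mat :: "(nat \<Rightarrow> nat) \<Rightarrow> nat \<Rightarrow> complex mat" where
  "U_mat m p = mat1 (m p) (m p) (\<lambda>i k. kdelta (int (m p) - i - k + 1))"

definition U_tilde :: "(nat \<Rightarrow> nat) \<Rightarrow> nat \<Rightarrow> complex mat" where
  "U_tilde m k = (let d = m k * m 3 in
     four_block_mat (0\<^sub>m d d) (- (U_mat m k \<otimes>\<^sub>K U_mat m 3)) (U_mat m k \<otimes>\<^sub>K U_mat m 3) (0\<^sub>m d d))"

definition q_fun :: "(nat \<Rightarrow> nat) \<Rightarrow> (nat \<Rightarrow> complex) \<Rightarrow> complex" where
  "q_fun m \<mu> = ((\<mu> 1 - \<i>/2) / (\<mu> 1 + \<i>/2)) ^ m 1 * ((\<mu> 2 - \<i>/2) / (\<mu> 2 + \<i>/2)) ^ m 2"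

definition a_coeff :: "int \<Rightarrow> complex" where
  "a_coeff r = (if r < 0 then 0 else if r = 0 then \<i>/2 else \<i>)"

definition A_cal :: "(nat \<Rightarrow> nat) \<Rightarrow> nat \<Rightarrow> complex mat" where
  "A_cal m p = mat1 (m p) (m p) (\<lambda>j l. a_coeff (j - l))"

definition A_mat :: "(nat \<Rightarrow> nat) \<Rightarrow> nat \<Rightarrow> complex mat" where
  "A_mat m p = (if p = 1 then A_cal m 1 \<otimes>\<^sub>K 1\<^sub>m (m 2) \<otimes>\<^sub>K 1\<^sub>m (m 3)
                else 1\<^sub>m (m 1) \<otimes>\<^sub>K A_cal m 2 \<otimes>\<^sub>K 1\<^sub>m (m 3))"

definition L_mat :: "(nat \<Rightarrow> nat) \<Rightarrow> complex mat" where
  "L_mat m = ones (m 1 * m 2) \<otimes>\<^sub>K 1\<^sub>m (m 3)"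

definition L_part :: "(nat \<Rightarrow> nat) \<Rightarrow> nat \<Rightarrow> complex mat" where
  "L_part m p = ones (m p) \<otimes>\<^sub>K 1\<^sub>m (m 3)"

type_synonym blocks = "int \<Rightarrow> int \<Rightarrow> complex mat"

definition T_cal :: "(nat \<Rightarrow> nat) \<Rightarrow> blocks \<Rightarrow> int \<Rightarrow> complex mat" where
  "T_cal m t r = block_mat (m 2) (m 2) (m 3) (m 3) (\<lambda>i k. t r (i - k))"

definition tbt_mat :: "(nat \<Rightarrow> nat) \<Rightarrow> blocks \<Rightarrow> complex mat" where
  "tbt_mat m t = block_mat (m 1) (m 1) (m 2 * m 3) (m 2 * m 3) (\<lambda>i k. T_cal m t (i - k))"

definition M11 :: "(nat \<Rightarrow> nat) \<Rightarrow> blocks \<Rightarrow> complex mat" where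
  "M11 m t = block_mat (m 1) 1 (m 2 * m 3) (m 2 * m 3) (\<lambda>i _. half_sum (T_cal m t) i)"

definition M21 :: "(nat \<Rightarrow> nat) \<Rightarrow> complex mat" where
  "M21 m = mat_adjoint (ones (m 1)) \<otimes>\<^sub>K 1\<^sub>m (m 2 * m 3)"

definition M31 :: "(nat \<Rightarrow> nat) \<Rightarrow> complex mat" where
  "M31 m = mat_adjoint (M21 m)"

definition M41 :: "(nat \<Rightarrow> nat) \<Rightarrow> blocks \<Rightarrow> complex mat" where
  "M41 m t = block_mat 1 (m 1) (m 2 * m 3) (m 2 * m 3)
     (\<lambda>_ k. half_sum (\<lambda>s. T_cal m t (- s)) k)"

definition M12_part :: "(nat \<Rightarrow> nat) \<Rightarrow> blocks \<Rightarrow> int \<Rightarrow> complex mat" where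
  "M12_part m t r = block_mat (m 2) 1 (m 3) (m 3) (\<lambda>i _. half_sum (t r) i)"

definition M12 :: "(nat \<Rightarrow> nat) \<Rightarrow> blocks \<Rightarrow> complex mat" where
  "M12 m t = block_mat (m 1) (m 1) (m 2 * m 3) (m 3) (\<lambda>i k. M12_part m t (i - k))"

definition M22 :: "(nat \<Rightarrow> nat) \<Rightarrow> complex mat" where
  "M22 m = 1\<^sub>m (m 1) \<otimes>\<^sub>K mat_adjoint (ones (m 2)) \<otimes>\<^sub>K 1\<^sub>m (m 3)"

definition M32 :: "(nat \<Rightarrow> nat) \<Rightarrow> complex mat" where
  "M32 m = mat_adjoint (M22 m)"

definition M42_part :: "(nat \<Rightarrow> nat) \<Rightarrow> blocks \<Rightarrow> int \<Rightarrow> complex mat" where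
  "M42_part m t r = block_mat 1 (m 2) (m 3) (m 3) (\<lambda>_ k. half_sum (\<lambda>s. t r (- s)) k)"

definition M42 :: "(nat \<Rightarrow> nat) \<Rightarrow> blocks \<Rightarrow> complex mat" where
  "M42 m t = block_mat (m 1) (m 1) (m 3) (m 2 * m 3) (\<lambda>i k. M42_part m t (i - k))"

definition Pi_mat :: "(nat \<Rightarrow> nat) \<Rightarrow> blocks \<Rightarrow> nat \<Rightarrow> complex mat" where
  "Pi_mat m t p = (if p = 1 then M11 m t @\<^sub>c M31 m else M12 m t @\<^sub>c M32 m)"

definition Pi_hat :: "(nat \<Rightarrow> nat) \<Rightarrow> blocks \<Rightarrow> nat \<Rightarrow> complex mat" where
  "Pi_hat m t p = (if p = 1 then M21 m @\<^sub>r M41 m t else M22 m @\<^sub>r M42 m t)"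

definition Gamma_mat :: "(nat \<Rightarrow> nat) \<Rightarrow> blocks \<Rightarrow> nat \<Rightarrow> complex mat" where
  "Gamma_mat m t p = mat_inv (tbt_mat m t) * Pi_mat m t p"

definition Gamma_hat :: "(nat \<Rightarrow> nat) \<Rightarrow> blocks \<Rightarrow> nat \<Rightarrow> complex mat" where
  "Gamma_hat m t p = Pi_hat m t p * mat_inv (tbt_mat m t)"

definition v_fun :: "(nat \<Rightarrow> nat) \<Rightarrow> blocks \<Rightarrow> nat \<Rightarrow> (nat \<Rightarrow> complex) \<Rightarrow> complex mat" where
  "v_fun m t p \<mu> = (let I = 1\<^sub>m (m 1 * m 2 * m 3) in
     mat_adjoint (L_mat m)
       * (mat_inv (mat_adjoint (A_mat m 1) - \<mu> 1 \<cdot>\<^sub>m I)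
           * mat_inv (mat_adjoint (A_mat m 2) - \<mu> 2 \<cdot>\<^sub>m I))
       * Gamma_mat m t p)"

definition v_hat_fun :: "(nat \<Rightarrow> nat) \<Rightarrow> blocks \<Rightarrow> nat \<Rightarrow> (nat \<Rightarrow> complex) \<Rightarrow> complex mat" where
  "v_hat_fun m t p \<mu> = (let I = 1\<^sub>m (m 1 * m 2 * m 3) in
     Gamma_hat m t p
       * (mat_inv (A_mat m 1 - \<mu> 1 \<cdot>\<^sub>m I) * mat_inv (A_mat m 2 - \<mu> 2 \<cdot>\<^sub>m I))
       * L_mat m)"

text \<open>In \<open>u_fun\<close> and \<open>u_hat_fun\<close>, \<open>k\<close> is the element of $\{1,2\}$ different from \<open>p\<close>.\<close>

definition u_fun :: "(nat \<Rightarrow> nat) \<Rightarrow> blocks \<Rightarrow> nat \<Rightarrow> (nat \<Rightarrow> complex) \<Rightarrow> complex mat" where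
  "u_fun m t p \<mu> = (let k = 3 - p; d = m k * m 3 in
     v_fun m t p \<mu>
     - \<i> \<cdot>\<^sub>m (((mat_adjoint (ones (m k)) * mat_inv (mat_adjoint (A_cal m k) - \<mu> k \<cdot>\<^sub>m 1\<^sub>m (m k)))
               \<otimes>\<^sub>K 1\<^sub>m (m 3))
            * (1\<^sub>m d @\<^sub>c 0\<^sub>m d d)))"

definition u_hat_fun :: "(nat \<Rightarrow> nat) \<Rightarrow> blocks \<Rightarrow> nat \<Rightarrow> (nat \<Rightarrow> complex) \<Rightarrow> complex mat" where
  "u_hat_fun m t p \<mu> = (let k = 3 - p; d = m k * m 3 in
     v_hat_fun m t p \<mu>
     + \<i> \<cdot>\<^sub>m ((0\<^sub>m d d @\<^sub>r 1\<^sub>m d)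
            * ((mat_inv (A_cal m k - \<mu> k \<cdot>\<^sub>m 1\<^sub>m (m k)) * ones (m k)) \<otimes>\<^sub>K 1\<^sub>m (m 3))))"

definition K11 :: "(nat \<Rightarrow> nat) \<Rightarrow> blocks \<Rightarrow> complex mat" where
  "K11 m t = block_mat (m 1) 1 (m 3) (m 2 * m 3) (\<lambda>i _. half_sum (M42_part m t) i)"

definition K12 :: "(nat \<Rightarrow> nat) \<Rightarrow> blocks \<Rightarrow> complex mat" where
  "K12 m t = block_mat 1 (m 1) (m 2 * m 3) (m 3) (\<lambda>_ k. half_sum (\<lambda>j. M12_part m t (- j)) k)"

definition G21 :: "(nat \<Rightarrow> nat) \<Rightarrow> blocks \<Rightarrow> complex mat" where
  "G21 m t = \<i> \<cdot>\<^sub>m (Pi_hat m t 2 * Gamma_mat m t 1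
     - four_block_mat (L_part m 1 * mat_adjoint (L_part m 2)) (0\<^sub>m (m 1 * m 3) (m 2 * m 3))
                      (K11 m t)                               (0\<^sub>m (m 1 * m 3) (m 2 * m 3)))"

definition G12 :: "(nat \<Rightarrow> nat) \<Rightarrow> blocks \<Rightarrow> complex mat" where
  "G12 m t = \<i> \<cdot>\<^sub>m (Pi_hat m t 1 * Gamma_mat m t 2
     - four_block_mat (L_part m 2 * mat_adjoint (L_part m 1)) (0\<^sub>m (m 2 * m 3) (m 1 * m 3))
                      (K12 m t)                               (0\<^sub>m (m 2 * m 3) (m 1 * m 3)))"

end

theory Submission
  imports Defs
begin

text \<open>
Write $J_n$ for the $n \times n$ matrix with ones on the antidiagonal and
$A^\sharp = J A^\tau J$ for the reflection of $A$ in its antidiagonal (\<open>antitr\<close> below).  The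
map $\sharp$ is an involution that reverses the order of products, and every $U_p$ as well as every Kronecker product
of the $U_p$ is some $J_n$.  The DSTU condition says $t^\sharp = t$ for every block; since Toeplitz
matrices are fixed by the reflection, $\mathcal T_r^\sharp = \mathcal T_r$, $T^\sharp = T$ and hence
$R^\sharp = R$.

The displacement factors become related by
  $$M_{2p}^\sharp = M_{3p}, \qquad M_{1p} + M_{4p}^\sharp = T M_{3p} .$$
The second identity holds because $T M_{3p}$ sums the blocks of a block row; such a sum splits at
the diagonal into two half sums, each taking one half of the diagonal block, and $\sharp$ reverses
the order of the blocks in $M_{4p}$.  The identity for $p = 2$ is the identity for one level, applied
to every block.  The same identities give
  $$K_{11} + M_{22} M_{41}^\sharp = K_{12}^\sharp + M_{42} M_{31} .$$

Multiplication with the matrices $\widetilde U_k$ only rearranges blocks: for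
$X = \left[\begin{smallmatrix} a & b \cr c & d \end{smallmatrix}\right]$ one has
$\widetilde U_k X^\tau \widetilde U_p =
  \left[\begin{smallmatrix} -d^\sharp & b^\sharp \cr c^\sharp & -a^\sharp \end{smallmatrix}\right]$.
Hence the formula for $G_{21}$ is four identities between blocks, and each of them follows from the
relations above together with $R T = T R = I$ and
$M_{22} M_{31} = \mathcal L_1 \mathcal L_2^*$ (\<open>G_21_from_displacement\<close>).

For $u_p$ let $w_i = (\mathcal A_i - \mu_i)^{-1} \mathbf 1$ and
$z_i = \bigl((\mu_i - \mathrm i/2)/(\mu_i + \mathrm i/2)\bigr)^{m_i}$.  As
$\mathcal A_i^* = \mathcal A_i - \mathrm i\, \mathbf 1 \mathbf 1^*$ is a rank one perturbation,
$\mathbf 1^* (\mathcal A_i^* - \mu_i)^{-1}$ is a multiple of $w_i^\sharp$.  The entries of $w_i$ form a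
geometric progression, which shows that the multiple is $z_i$ and that
$z_i w_i^\sharp \mathbf 1 = \mathrm i (1 - z_i)$.  So the left resolvent factor in $v_p$ is
$q(\mu)$ times the reflection of the right resolvent factor in $\widehat v_p$.  In
$u_p + q\, U_3 \widehat u_p^\tau \widetilde U_k$ the relations between the $M_{jp}$ leave one term,
coming from $R T M_{3p} = M_{3p}$.  It is $\mathrm i (1 - z_p)$ times a row of resolvents, and the
correction terms of $u_p$ and $\widehat u_p$ contribute $- \mathrm i$ and $\mathrm i z_p$ times the
same row (\<open>u_from_displacement\<close>).
\<close>

section \<open>Matrix arithmetic under dimension conditions\<close>

text \<open>
The ring laws are stated with equations between dimensions as hypotheses, which the simplifier can
discharge; carrier conditions would leave dimensions to be guessed.
\<close>

lemma index_mult_mat_sum: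
  assumes "i < dim_row A" "j < dim_col B" "dim_col A = dim_row B"
  shows "(A * B) $$ (i, j) = (\<Sum>k = 0..<dim_row B. A $$ (i, k) * B $$ (k, j))"
  using assms by (auto simp: scalar_prod_def intro!: sum.cong)

lemma mult_mat_assoc_dim:
  assumes "dim_col A = dim_row B" "dim_col B = dim_row C"
  shows "A * B * C = A * (B * C :: complex mat)"
  using assms by (intro assoc_mult_mat carrier_matI) auto

lemma mult_mat_diff_dim:
  assumes "dim_col A = dim_row B" "dim_row B = dim_row C" "dim_col B = dim_col C"
  shows "A * (B - C) = A * B - A * (C :: complex mat)"
  using assms by (intro mult_minus_distrib_mat carrier_matI) auto

lemma diff_mult_mat_dim:
  assumes "dim_col A = dim_row C" "dim_row A = dim_row B" "dim_col A = dim_col B"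
  shows "(A - B) * C = A * C - B * (C :: complex mat)"
  using assms by (intro minus_mult_distrib_mat carrier_matI) auto

lemma smult_mult_mat_dim:
  assumes "dim_col A = dim_row B"
  shows "(c \<cdot>\<^sub>m A) * B = c \<cdot>\<^sub>m (A * B :: complex mat)"
  using assms by (intro mult_smult_assoc_mat carrier_matI) auto

lemma mult_smult_mat_dim:
  assumes "dim_col A = dim_row B"
  shows "A * (c \<cdot>\<^sub>m B) = c \<cdot>\<^sub>m (A * B :: complex mat)"
  using assms by (intro mult_smult_distrib carrier_matI) auto

lemma diff_eq_if_add_eq:
  fixes A B C :: "complex mat"
  assumes "A + B = C" "dim_row A = dim_row B" "dim_col A = dim_col B"
  shows "A = C - B"
  unfolding assms(1)[symmetric] using assms(2,3) by (intro eq_matI) auto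

text \<open>
The bookkeeping of scalars that identifies the part of $u_p$ where $R$ cancels against $T$.
\<close>

lemma smult_mult_smult:
  fixes X M Y :: "complex mat"
  assumes "X * M = s \<cdot>\<^sub>m Y" "q * s = a * b" "dim_col X = dim_row M"
  shows "(q \<cdot>\<^sub>m X) * M = a \<cdot>\<^sub>m (b \<cdot>\<^sub>m Y)"
  unfolding smult_mult_mat_dim[OF assms(3)] assms(1)
  by (rule eq_matI) (simp_all add: assms(2) flip: mult.assoc)

lemma index_mat_adjoint:
  assumes "i < dim_col A" "j < dim_row A"
  shows "mat_adjoint A $$ (i, j) = cnj (A $$ (j, i))"
  using assms by (simp add: mat_adjoint_def mat_of_rows_def conjugate_complex_def)

lemma dim_mat_adjoint [simp]:
  "dim_row (mat_adjoint A) = dim_col A" "dim_col (mat_adjoint A) = dim_row A"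
  by (auto simp: mat_adjoint_def)

lemma mat_adjoint_one [simp]: "mat_adjoint (1\<^sub>m n) = (1\<^sub>m n :: complex mat)"
  by (rule eq_matI) (auto simp: index_mat_adjoint)

text \<open>
For square matrices a one-sided inverse suffices, so an inverse can be exhibited instead of computed.
\<close>

lemma mat_inv_eqI:
  assumes "A \<in> carrier_mat n n" "B \<in> carrier_mat n n" "A * B = 1\<^sub>m n"
  shows "mat_inv A = B"
proof -
  have BA: "B * A = 1\<^sub>m n" using mat_mult_left_right_inverse assms by blast
  have "A \<in> Units (ring_mat TYPE(complex) n ())"
    using assms BA unfolding Units_def ring_mat_def by auto
  then obtain C where C: "mat_inverse A = Some C"
    using mat_inverse(1)[OF assms(1), where b = "()"] by (cases "mat_inverse A") auto
  from mat_inverse(2)[OF assms(1) C] have AC: "A * C = 1\<^sub>m n" "C \<in> carrier_mat n n" by auto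
  have "B = B * (A * C)" using AC assms by simp
  also have "\<dots> = (B * A) * C" using AC assms by (intro assoc_mult_mat[symmetric]) auto
  also have "\<dots> = C" using BA AC by simp
  finally show ?thesis using C by (simp add: mat_inv_def)
qed

lemma mat_inv_invertible:
  assumes "A \<in> carrier_mat n n" "invertible_mat A"
  shows "mat_inv A \<in> carrier_mat n n" "A * mat_inv A = 1\<^sub>m n" "mat_inv A * A = 1\<^sub>m n"
proof -
  from assms obtain B where AB: "A * B = 1\<^sub>m n" and BA: "B * A = 1\<^sub>m (dim_row B)"
    unfolding invertible_mat_def inverts_mat_def by auto
  have "dim_col B = n" using arg_cong[OF AB, of dim_col] by simp
  moreover have "dim_row B = n" using arg_cong[OF BA, of dim_col] assms by simp
  ultimately have B: "B \<in> carrier_mat n n" by auto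
  have "mat_inv A = B" by (rule mat_inv_eqI[OF assms(1) B AB])
  then show "mat_inv A \<in> carrier_mat n n" "A * mat_inv A = 1\<^sub>m n" "mat_inv A * A = 1\<^sub>m n"
    using AB BA B by auto
qed

lemma mat_inv_det:
  assumes "A \<in> carrier_mat n n" "det A \<noteq> 0"
  shows "mat_inv A \<in> carrier_mat n n" "A * mat_inv A = 1\<^sub>m n" "mat_inv A * A = 1\<^sub>m n"
proof -
  have "A \<in> Units (ring_mat TYPE(complex) n ())" by (rule det_non_zero_imp_unit[OF assms])
  then obtain C where C: "mat_inverse A = Some C"
    using mat_inverse(1)[OF assms(1), where b = "()"] by (cases "mat_inverse A") auto
  then have inv: "mat_inv A = C" by (simp add: mat_inv_def)
  show "mat_inv A \<in> carrier_mat n n" "A * mat_inv A = 1\<^sub>m n" "mat_inv A * A = 1\<^sub>m n"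
    using mat_inverse(2)[OF assms(1) C] unfolding inv by blast+
qed

section \<open>Block matrices and Kronecker products\<close>

lemma block_index_less:
  fixes i r a n :: nat
  assumes "i < a" "r < n"
  shows "i * n + r < a * n"
proof -
  have "i * n + r < Suc i * n" using assms by simp
  also have "\<dots> \<le> a * n" using assms by (intro mult_right_mono) auto
  finally show ?thesis .
qed

text \<open>
Reversing a composite index reverses both of its digits.  This is why the reflection of a block
matrix reflects the arrangement of the blocks and each block separately.
\<close>

lemma block_index_reverse:
  fixes i r a n :: nat
  assumes "i < a" "r < n"
  shows "a * n - Suc (i * n + r) = (a - Suc i) * n + (n - Suc r)"
proof -
  obtain d e where "a = Suc (i + d)" "n = Suc (r + e)"
    using assms less_iff_Suc_add by metis
  then show ?thesis by (simp add: algebra_simps)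
qed

lemma block_index_eq_iff:
  fixes i r k s n :: nat
  assumes "r < n" "s < n"
  shows "i * n + r = k * n + s \<longleftrightarrow> i = k \<and> r = s"
proof -
  have "(i * n + r) div n = i" "(i * n + r) mod n = r" "(k * n + s) div n = k" "(k * n + s) mod n = s"
    using assms by auto
  then show ?thesis by metis
qed

lemma eq_block_matI:
  assumes "dim_row A = a * n" "dim_row B = a * n" "dim_col A = b * c" "dim_col B = b * c"
    and eq: "\<And>i r k s. i < a \<Longrightarrow> r < n \<Longrightarrow> k < b \<Longrightarrow> s < c \<Longrightarrow>
           A $$ (i * n + r, k * c + s) = B $$ (i * n + r, k * c + s)"
  shows "A = B"
proof (rule eq_matI)
  fix x y assume "x < dim_row B" "y < dim_col B"
  then have xy: "x < a * n" "y < b * c" using assms by auto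
  then have "n > 0" "c > 0" by (auto intro!: Nat.gr0I)
  moreover have "x div n < a" "y div c < b"
    using xy by (auto simp: less_mult_imp_div_less)
  ultimately show "A $$ (x, y) = B $$ (x, y)"
    using eq[of "x div n" "x mod n" "y div c" "y mod c"] by simp
qed (use assms in auto)

lemma dim_block_mat [simp]:
  "dim_row (block_mat a b n c F) = a * n" "dim_col (block_mat a b n c F) = b * c"
  by (auto simp: block_mat_def)

lemma index_block_mat:
  assumes "i < a" "r < n" "k < b" "s < c"
  shows "block_mat a b n c F $$ (i * n + r, k * c + s) = F (int i + 1) (int k + 1) $$ (r, s)"
  using assms block_index_less[of i a r n] block_index_less[of k b s c]
  by (simp add: block_mat_def)

lemma sum_block_index:
  fixes f :: "nat \<Rightarrow> complex"
  shows "(\<Sum>x = 0..<a * n. f x) = (\<Sum>i = 0..<a. \<Sum>r = 0..<n. f (i * n + r))"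
proof -
  have "(\<Sum>x = 0..<a * n. f x) = (\<Sum>i<a. \<Sum>x = i * n..<i * n + n. f x)"
    using sum.nat_group[of f n a] by (simp add: atLeast0LessThan mult.commute)
  also have "\<dots> = (\<Sum>i = 0..<a. \<Sum>r = 0..<n. f (i * n + r))"
    using sum.shift_bounds_nat_ivl[of f 0 "_ * n" n]
    by (simp add: atLeast0LessThan add.commute)
  finally show ?thesis .
qed

lemma block_mat_cong:
  assumes "\<And>i k. 1 \<le> i \<Longrightarrow> i \<le> int a \<Longrightarrow> 1 \<le> k \<Longrightarrow> k \<le> int b \<Longrightarrow> F i k = G i k"
  shows "block_mat a b n c F = block_mat a b n c G"
  by (rule eq_block_matI[of _ a n _ b c]) (auto simp: index_block_mat assms)

lemma block_mat_add:
  assumes "\<And>i k. 1 \<le> i \<Longrightarrow> i \<le> int a \<Longrightarrow> 1 \<le> k \<Longrightarrow> k \<le> int b \<Longrightarrow> G i k \<in> carrier_mat n c"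
  shows "block_mat a b n c F + block_mat a b n c G = block_mat a b n c (\<lambda>i k. F i k + G i k)"
proof (rule eq_block_matI[of _ a n _ b c])
  fix i r k s assume *: "i < a" "r < n" "k < b" "s < c"
  then have "G (int i + 1) (int k + 1) \<in> carrier_mat n c" by (intro assms) auto
  with * show "(block_mat a b n c F + block_mat a b n c G) $$ (i * n + r, k * c + s) =
    block_mat a b n c (\<lambda>i k. F i k + G i k) $$ (i * n + r, k * c + s)"
    by (simp add: index_block_mat block_index_less)
qed auto

lemma dim_kron [simp]:
  "dim_row (A \<otimes>\<^sub>K B) = dim_row A * dim_row B" "dim_col (A \<otimes>\<^sub>K B) = dim_col A * dim_col B"
  by (auto simp: kron_def)

lemma index_kron:
  assumes "i < dim_row A" "r < dim_row B" "k < dim_col A" "s < dim_col B"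
  shows "(A \<otimes>\<^sub>K B) $$ (i * dim_row B + r, k * dim_col B + s) = A $$ (i, k) * B $$ (r, s)"
  using assms block_index_less[of i "dim_row A" r "dim_row B"]
    block_index_less[of k "dim_col A" s "dim_col B"]
  by (simp add: kron_def)

text \<open>
The mixed product rule, obtained by splitting the summation index into its two digits.
\<close>

lemma kron_mult:
  assumes "dim_col A = dim_row C" "dim_col B = dim_row D"
  shows "(A \<otimes>\<^sub>K B) * (C \<otimes>\<^sub>K D) = (A * C) \<otimes>\<^sub>K (B * D)"
proof (rule eq_block_matI[of _ "dim_row A" "dim_row B" _ "dim_col C" "dim_col D"])
  fix i r k s
  assume *: "i < dim_row A" "r < dim_row B" "k < dim_col C" "s < dim_col D"
  have "((A \<otimes>\<^sub>K B) * (C \<otimes>\<^sub>K D)) $$ (i * dim_row B + r, k * dim_col D + s) =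
     (\<Sum>x = 0..<dim_row C * dim_row D. (A \<otimes>\<^sub>K B) $$ (i * dim_row B + r, x) * (C \<otimes>\<^sub>K D) $$ (x, k * dim_col D + s))"
    using * assms by (subst index_mult_mat_sum) (auto intro: block_index_less)
  also have "\<dots> = (\<Sum>l = 0..<dim_row C. \<Sum>u = 0..<dim_row D.
      (A $$ (i, l) * B $$ (r, u)) * (C $$ (l, k) * D $$ (u, s)))"
    unfolding sum_block_index using * assms
      index_kron[of i A r B _ ] index_kron[of _ C _ D k s]
    by (intro sum.cong refl) (auto simp flip: assms)
  also have "\<dots> = (A * C) $$ (i, k) * (B * D) $$ (r, s)"
    using * assms by (subst (1 2) index_mult_mat_sum) (auto simp: sum_product mult_ac)
  also have "\<dots> = ((A * C) \<otimes>\<^sub>K (B * D)) $$ (i * dim_row B + r, k * dim_col D + s)"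
    using * index_kron[of i "A * C" r "B * D" k s] by simp
  finally show "((A \<otimes>\<^sub>K B) * (C \<otimes>\<^sub>K D)) $$ (i * dim_row B + r, k * dim_col D + s) =
    ((A * C) \<otimes>\<^sub>K (B * D)) $$ (i * dim_row B + r, k * dim_col D + s)" .
qed auto

lemma kron_assoc: "A \<otimes>\<^sub>K B \<otimes>\<^sub>K C = A \<otimes>\<^sub>K (B \<otimes>\<^sub>K C)"
proof (rule eq_matI)
  fix x y
  assume "x < dim_row (A \<otimes>\<^sub>K (B \<otimes>\<^sub>K C))" "y < dim_col (A \<otimes>\<^sub>K (B \<otimes>\<^sub>K C))"
  then have x: "x < dim_row A * dim_row B * dim_row C"
    and y: "y < dim_col A * dim_col B * dim_col C" by (auto simp: mult_ac)
  from x have "dim_row B > 0" "dim_row C > 0" by (auto intro!: Nat.gr0I)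
  moreover from y have "dim_col B > 0" "dim_col C > 0" by (auto intro!: Nat.gr0I)
  moreover have "x div dim_row C < dim_row A * dim_row B" "y div dim_col C < dim_col A * dim_col B"
    using x y by (auto intro!: less_mult_imp_div_less)
  moreover have "x mod (dim_row B * dim_row C) < dim_row B * dim_row C"
      "y mod (dim_col B * dim_col C) < dim_col B * dim_col C"
    using calculation by auto
  moreover have "x mod (b * c) div c = x div c mod b" "x mod (b * c) mod c = x mod c"
    if "c > 0" for x b c :: nat
    using that by (simp_all add: mult.commute[of b c] mod_mult2_eq)
  ultimately show "(A \<otimes>\<^sub>K B \<otimes>\<^sub>K C) $$ (x, y) = (A \<otimes>\<^sub>K (B \<otimes>\<^sub>K C)) $$ (x, y)"
    using x y by (simp add: kron_def div_mult2_eq[symmetric] mult.commute[of "dim_row C"] mult.commute[of "dim_col C"] mult.assoc)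
qed (auto simp: mult_ac)

lemma kron_one: "1\<^sub>m a \<otimes>\<^sub>K 1\<^sub>m b = 1\<^sub>m (a * b)"
proof (rule eq_block_matI[of _ a b _ a b])
  fix i r k s assume *: "i < a" "r < b" "k < a" "s < b"
  have "i * b + r = k * b + s \<longleftrightarrow> i = k \<and> r = s"
    using * by (intro block_index_eq_iff)
  then show "(1\<^sub>m a \<otimes>\<^sub>K 1\<^sub>m b) $$ (i * b + r, k * b + s) = 1\<^sub>m (a * b) $$ (i * b + r, k * b + s)"
    using * index_kron[of i "1\<^sub>m a" r "1\<^sub>m b" k s] by (auto simp: block_index_less)
qed auto

lemma kron_one_left [simp]: "1\<^sub>m 1 \<otimes>\<^sub>K A = A"
  by (rule eq_matI) (auto simp: kron_def)

lemma kron_smult_left: "(c \<cdot>\<^sub>m A) \<otimes>\<^sub>K B = c \<cdot>\<^sub>m (A \<otimes>\<^sub>K B)"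
  by (rule eq_block_matI[of _ "dim_row A" "dim_row B" _ "dim_col A" "dim_col B"])
     (auto simp: block_index_less index_kron index_kron[of _ "c \<cdot>\<^sub>m A", simplified])

lemma kron_smult_right: "A \<otimes>\<^sub>K (c \<cdot>\<^sub>m B) = c \<cdot>\<^sub>m (A \<otimes>\<^sub>K B)"
  by (rule eq_block_matI[of _ "dim_row A" "dim_row B" _ "dim_col A" "dim_col B"])
     (auto simp: block_index_less index_kron index_kron[of _ _ _ "c \<cdot>\<^sub>m B", simplified])

lemma kron_diff_left:
  assumes "dim_row A = dim_row B" "dim_col A = dim_col B"
  shows "(A - B) \<otimes>\<^sub>K C = (A \<otimes>\<^sub>K C) - (B \<otimes>\<^sub>K C)"
  by (rule eq_block_matI[of _ "dim_row B" "dim_row C" _ "dim_col B" "dim_col C"])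
     (auto simp: block_index_less index_kron index_kron[of _ A, simplified assms]
       index_kron[of _ "A - B", simplified] assms left_diff_distrib)

lemma kron_diff_right:
  assumes "dim_row A = dim_row B" "dim_col A = dim_col B"
  shows "C \<otimes>\<^sub>K (A - B) = (C \<otimes>\<^sub>K A) - (C \<otimes>\<^sub>K B)"
  by (rule eq_block_matI[of _ "dim_row C" "dim_row B" _ "dim_col C" "dim_col B"])
     (auto simp: block_index_less index_kron index_kron[of _ _ _ A, simplified assms]
       index_kron[of _ _ _ "A - B", simplified] assms right_diff_distrib)

lemma mat_adjoint_kron: "mat_adjoint (A \<otimes>\<^sub>K B) = mat_adjoint A \<otimes>\<^sub>K mat_adjoint B"
  by (rule eq_block_matI[of _ "dim_col A" "dim_col B" _ "dim_row A" "dim_row B"])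
     (auto simp: block_index_less index_kron index_mat_adjoint
        index_kron[of _ "mat_adjoint A" _ "mat_adjoint B", simplified])

lemma kron_col_row:
  assumes "dim_col A = 1" "dim_row B = 1"
  shows "A \<otimes>\<^sub>K B = A * B"
  using assms by (intro eq_matI) (auto simp: kron_def index_mult_mat_sum simp del: index_mult_mat(1))

lemma kron_kron_one_mult:
  assumes "dim_col A = dim_row C" "dim_col B = dim_row D"
  shows "(A \<otimes>\<^sub>K B \<otimes>\<^sub>K 1\<^sub>m c) * (C \<otimes>\<^sub>K D \<otimes>\<^sub>K 1\<^sub>m c) = (A * C) \<otimes>\<^sub>K (B * D) \<otimes>\<^sub>K 1\<^sub>m c"
  using assms by (simp add: kron_mult)

text \<open>
Operators acting on different tensor factors multiply to one elementary tensor; this separates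
the two resolvents in $v_p$ and $\widehat v_p$.
\<close>

lemma kron_commuting_factors:
  assumes "A \<in> carrier_mat a a" "B \<in> carrier_mat b b"
  shows "(A \<otimes>\<^sub>K 1\<^sub>m b \<otimes>\<^sub>K 1\<^sub>m c) * (1\<^sub>m a \<otimes>\<^sub>K B \<otimes>\<^sub>K 1\<^sub>m c) = A \<otimes>\<^sub>K B \<otimes>\<^sub>K 1\<^sub>m c"
  using assms by (subst kron_kron_one_mult) auto

lemma mat_inv_kron:
  assumes "A \<in> carrier_mat a a" "A' \<in> carrier_mat a a" "A * A' = 1\<^sub>m a"
    and "B \<in> carrier_mat b b" "B' \<in> carrier_mat b b" "B * B' = 1\<^sub>m b"
  shows "mat_inv (A \<otimes>\<^sub>K B) = A' \<otimes>\<^sub>K B'"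
proof (rule mat_inv_eqI)
  show "(A \<otimes>\<^sub>K B) * (A' \<otimes>\<^sub>K B') = 1\<^sub>m (a * b)"
    using assms by (subst kron_mult) (auto simp: kron_one)
qed (use assms in auto)

text \<open>
A resolvent acts on its own tensor factor only, because the shift is a multiple of the identity
on that factor.
\<close>

lemma mat_inv_kron_shift_left:
  assumes "A \<in> carrier_mat a a" "A' \<in> carrier_mat a a" "(A - \<mu> \<cdot>\<^sub>m 1\<^sub>m a) * A' = 1\<^sub>m a"
  shows "mat_inv (A \<otimes>\<^sub>K 1\<^sub>m b \<otimes>\<^sub>K 1\<^sub>m c - \<mu> \<cdot>\<^sub>m 1\<^sub>m (a * b * c)) = A' \<otimes>\<^sub>K 1\<^sub>m b \<otimes>\<^sub>K 1\<^sub>m c"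
proof -
  have "A \<otimes>\<^sub>K 1\<^sub>m b \<otimes>\<^sub>K 1\<^sub>m c - \<mu> \<cdot>\<^sub>m 1\<^sub>m (a * b * c) = (A - \<mu> \<cdot>\<^sub>m 1\<^sub>m a) \<otimes>\<^sub>K 1\<^sub>m (b * c)"
    using assms(1) by (simp add: kron_diff_left kron_smult_left kron_assoc kron_one mult.assoc)
  moreover have "A - \<mu> \<cdot>\<^sub>m 1\<^sub>m a \<in> carrier_mat a a"
    by (rule carrier_matI) (use assms(1) in auto)
  ultimately show ?thesis
    using assms mat_inv_kron[of "A - \<mu> \<cdot>\<^sub>m 1\<^sub>m a" a A' "1\<^sub>m (b * c)" "b * c" "1\<^sub>m (b * c)"]
    by (simp add: kron_assoc kron_one)
qed

lemma mat_inv_kron_shift_middle: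
  assumes "A \<in> carrier_mat b b" "A' \<in> carrier_mat b b" "(A - \<mu> \<cdot>\<^sub>m 1\<^sub>m b) * A' = 1\<^sub>m b"
  shows "mat_inv (1\<^sub>m a \<otimes>\<^sub>K A \<otimes>\<^sub>K 1\<^sub>m c - \<mu> \<cdot>\<^sub>m 1\<^sub>m (a * b * c)) = 1\<^sub>m a \<otimes>\<^sub>K A' \<otimes>\<^sub>K 1\<^sub>m c"
proof -
  let ?B = "A - \<mu> \<cdot>\<^sub>m 1\<^sub>m b"
  have "1\<^sub>m a \<otimes>\<^sub>K A \<otimes>\<^sub>K 1\<^sub>m c - \<mu> \<cdot>\<^sub>m 1\<^sub>m (a * b * c) = 1\<^sub>m a \<otimes>\<^sub>K ?B \<otimes>\<^sub>K 1\<^sub>m c"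
    using assms(1)
    by (simp add: kron_diff_left kron_diff_right kron_smult_left kron_smult_right kron_one)
  moreover have "(1\<^sub>m a \<otimes>\<^sub>K ?B) * (1\<^sub>m a \<otimes>\<^sub>K A') = 1\<^sub>m (a * b)"
    using assms by (subst kron_mult) (auto simp: kron_one)
  moreover have "1\<^sub>m a \<otimes>\<^sub>K ?B \<in> carrier_mat (a * b) (a * b)" "1\<^sub>m a \<otimes>\<^sub>K A' \<in> carrier_mat (a * b) (a * b)"
    using assms(1,2) by (auto intro!: carrier_matI)
  ultimately show ?thesis
    using mat_inv_kron[of "1\<^sub>m a \<otimes>\<^sub>K ?B" "a * b" "1\<^sub>m a \<otimes>\<^sub>K A'" "1\<^sub>m c" c "1\<^sub>m c"]
    by simp
qed

section \<open>Reflection in the antidiagonal\<close>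

text \<open>
The matrix $A^\sharp = J A^\tau J$ for a rectangular $A$, given by entries so that no exchange matrix
appears in it; the link is \<open>exchange_transpose_exchange\<close>.
\<close>

definition antitr :: "complex mat \<Rightarrow> complex mat" where
  "antitr A = mat (dim_col A) (dim_row A) (\<lambda>(i, j). A $$ (dim_row A - Suc j, dim_col A - Suc i))"

lemma dim_antitr [simp]: "dim_row (antitr A) = dim_col A" "dim_col (antitr A) = dim_row A"
  by (auto simp: antitr_def)

lemma index_antitr:
  assumes "i < dim_col A" "j < dim_row A"
  shows "antitr A $$ (i, j) = A $$ (dim_row A - Suc j, dim_col A - Suc i)"
  using assms by (simp add: antitr_def)

lemma antitr_antitr [simp]: "antitr (antitr A) = A"
  by (rule eq_matI) (auto simp: index_antitr)

lemma antitr_one [simp]: "antitr (1\<^sub>m n) = 1\<^sub>m n"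
  by (rule eq_matI) (auto simp: index_antitr)

lemma antitr_smult: "antitr (c \<cdot>\<^sub>m A) = c \<cdot>\<^sub>m antitr A"
  by (rule eq_matI) (auto simp: index_antitr)

lemma antitr_add:
  assumes "dim_row A = dim_row B" "dim_col A = dim_col B"
  shows "antitr (A + B) = antitr A + antitr B"
  using assms by (intro eq_matI) (auto simp: index_antitr)

lemma antitr_diff:
  assumes "dim_row A = dim_row B" "dim_col A = dim_col B"
  shows "antitr (A - B) = antitr A - antitr B"
  using assms by (intro eq_matI) (auto simp: index_antitr)

lemma antitr_mult:
  assumes "dim_col A = dim_row B"
  shows "antitr (A * B) = antitr B * antitr A"
proof (rule eq_matI)
  fix i j assume "i < dim_row (antitr B * antitr A)" "j < dim_col (antitr B * antitr A)"
  then have *: "i < dim_col B" "j < dim_row A" by auto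
  have "(antitr B * antitr A) $$ (i, j) = (\<Sum>k = 0..<dim_row B. antitr B $$ (i, k) * antitr A $$ (k, j))"
    using * assms by (subst index_mult_mat_sum) auto
  also have "\<dots> = (\<Sum>k = 0..<dim_row B.
      B $$ (dim_row B - Suc k, dim_col B - Suc i) * A $$ (dim_row A - Suc j, dim_row B - Suc k))"
    using * assms by (intro sum.cong) (auto simp: index_antitr)
  also have "\<dots> = (\<Sum>k = 0..<dim_row B.
      A $$ (dim_row A - Suc j, k) * B $$ (k, dim_col B - Suc i))"
    by (subst sum.atLeastLessThan_rev) (auto simp: mult.commute intro!: sum.cong)
  also have "\<dots> = antitr (A * B) $$ (i, j)"
    using * assms by (auto simp: index_antitr index_mult_mat_sum simp del: index_mult_mat(1))
  finally show "antitr (A * B) $$ (i, j) = (antitr B * antitr A) $$ (i, j)" ..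
qed auto

text \<open>
In a block Toeplitz matrix the difference of the two reflected block indices is $i - k$ again, so
the reflection keeps the order of the blocks and acts on each of them.  In a block row or block
column it reverses the order.
\<close>

lemma antitr_block_mat:
  assumes "\<And>i k. 1 \<le> i \<Longrightarrow> i \<le> int a \<Longrightarrow> 1 \<le> k \<Longrightarrow> k \<le> int b \<Longrightarrow> F i k \<in> carrier_mat n c"
  shows "antitr (block_mat a b n c F) =
    block_mat b a c n (\<lambda>i k. antitr (F (int a + 1 - k) (int b + 1 - i)))"
proof (rule eq_block_matI[of _ b c _ a n])
  fix i r k s assume *: "i < b" "r < c" "k < a" "s < n"
  let ?F = "F (int a - int k) (int b - int i)"
  have F: "?F \<in> carrier_mat n c" using * by (intro assms) auto
  have "antitr (block_mat a b n c F) $$ (i * c + r, k * n + s) = ?F $$ (n - Suc s, c - Suc r)"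
    using * by (simp add: index_antitr block_index_less block_index_reverse index_block_mat del: Nat.add_diff_assoc)
  also have "\<dots> = antitr ?F $$ (r, s)"
    using F * by (auto simp: index_antitr)
  finally show "antitr (block_mat a b n c F) $$ (i * c + r, k * n + s) =
    block_mat b a c n (\<lambda>i k. antitr (F (int a + 1 - k) (int b + 1 - i))) $$ (i * c + r, k * n + s)"
    using * by (simp add: index_block_mat)
qed auto

lemma antitr_kron: "antitr (A \<otimes>\<^sub>K B) = antitr A \<otimes>\<^sub>K antitr B"
  by (rule eq_block_matI[of _ "dim_col A" "dim_col B" _ "dim_row A" "dim_row B"])
     (auto simp: index_antitr block_index_less block_index_reverse index_kron
       index_kron[of _ "antitr A" _ "antitr B", simplified] simp del: Nat.add_diff_assoc)

definition exchange :: "nat \<Rightarrow> complex mat" where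
  "exchange n = mat n n (\<lambda>(i, j). if j = n - Suc i then 1 else 0)"

lemma dim_exchange [simp]: "dim_row (exchange n) = n" "dim_col (exchange n) = n"
  by (auto simp: exchange_def)

lemma exchange_mult:
  assumes "dim_row A = n"
  shows "exchange n * A = mat n (dim_col A) (\<lambda>(i, j). A $$ (n - Suc i, j))"
  using assms by (intro eq_matI)
   (auto simp: index_mult_mat_sum exchange_def if_distrib[of "\<lambda>x. x * _"] simp del: index_mult_mat(1) cong: if_cong)

lemma mult_exchange:
  assumes "dim_col A = n"
  shows "A * exchange n = mat (dim_row A) n (\<lambda>(i, j). A $$ (i, n - Suc j))"
proof (rule eq_matI)
  fix i j assume "i < dim_row (mat (dim_row A) n (\<lambda>(i, j). A $$ (i, n - Suc j)))"
    "j < dim_col (mat (dim_row A) n (\<lambda>(i, j). A $$ (i, n - Suc j)))"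
  then have *: "i < dim_row A" "j < n" by auto
  have "(A * exchange n) $$ (i, j) = (\<Sum>k = 0..<n. A $$ (i, k) * (if k = n - Suc j then 1 else 0))"
    using * assms by (auto simp: index_mult_mat_sum exchange_def intro!: sum.cong simp del: index_mult_mat(1))
  then show "(A * exchange n) $$ (i, j) = mat (dim_row A) n (\<lambda>(i, j). A $$ (i, n - Suc j)) $$ (i, j)"
    using * by (simp add: if_distrib[of "\<lambda>x. _ * x"] cong: if_cong)
qed (use assms in auto)

lemma exchange_exchange: "exchange n * exchange n = 1\<^sub>m n"
  by (subst exchange_mult) (auto simp: exchange_def intro!: eq_matI)

lemma exchange_transpose_exchange: "exchange (dim_col A) * A\<^sup>T * exchange (dim_row A) = antitr A"
  by (subst exchange_mult, simp, subst mult_exchange) (auto simp: antitr_def intro!: eq_matI)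

lemma kron_exchange: "exchange a \<otimes>\<^sub>K exchange b = exchange (a * b)"
proof (rule eq_block_matI[of _ a b _ a b])
  fix i r k s assume *: "i < a" "r < b" "k < a" "s < b"
  have "k * b + s = (a - Suc i) * b + (b - Suc r) \<longleftrightarrow> k = a - Suc i \<and> s = b - Suc r"
    using * by (intro block_index_eq_iff) auto
  then show "(exchange a \<otimes>\<^sub>K exchange b) $$ (i * b + r, k * b + s) = exchange (a * b) $$ (i * b + r, k * b + s)"
    using * index_kron[of i "exchange a" r "exchange b" k s]
    by (auto simp: block_index_less exchange_def block_index_reverse)
qed auto

lemma U_mat_exchange: "U_mat m p = exchange (m p)"
  by (rule eq_matI) (auto simp: U_mat_def mat1_def exchange_def kdelta_def)

lemma dim_ones [simp]: "dim_row (ones n) = n" "dim_col (ones n) = 1"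
  by (auto simp: ones_def)

lemma mat_adjoint_ones: "mat_adjoint (ones n) = antitr (ones n)"
  by (rule eq_matI) (auto simp: index_mat_adjoint index_antitr ones_def)

lemma mat_adjoint_antitr_ones: "mat_adjoint (antitr (ones n)) = ones n"
  by (rule eq_matI) (auto simp: index_mat_adjoint index_antitr ones_def)

lemma kron_ones: "ones a \<otimes>\<^sub>K ones b = ones (a * b)"
proof (rule eq_matI)
  fix i j assume "i < dim_row (ones (a * b))" "j < dim_col (ones (a * b))"
  then have "i < a * b" "j = 0" by auto
  moreover from this have "b > 0" by (auto intro!: Nat.gr0I)
  ultimately show "(ones a \<otimes>\<^sub>K ones b) $$ (i, j) = ones (a * b) $$ (i, j)"
    by (simp add: kron_def ones_def less_mult_imp_div_less)
qed auto

section \<open>Half sums and block Toeplitz matrices\<close>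

text \<open>
Multiplication with $I \otimes B$ acts blockwise.  The second level of the Toeplitz structure is
handled by this lemma and its mirror image.
\<close>

lemma kron_one_mult_block_mat:
  assumes B: "dim_col B = n"
    and F: "\<And>i k. 1 \<le> i \<Longrightarrow> i \<le> int a \<Longrightarrow> 1 \<le> k \<Longrightarrow> k \<le> int b \<Longrightarrow> F i k \<in> carrier_mat n c"
  shows "(1\<^sub>m a \<otimes>\<^sub>K B) * block_mat a b n c F = block_mat a b (dim_row B) c (\<lambda>i k. B * F i k)"
proof (rule eq_block_matI[of _ a "dim_row B" _ b c])
  fix i r k s assume *: "i < a" "r < dim_row B" "k < b" "s < c"
  then have F': "F (int i + 1) (int k + 1) \<in> carrier_mat n c" by (intro F) auto
  have "((1\<^sub>m a \<otimes>\<^sub>K B) * block_mat a b n c F) $$ (i * dim_row B + r, k * c + s) =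
    (\<Sum>x = 0..<a * n. (1\<^sub>m a \<otimes>\<^sub>K B) $$ (i * dim_row B + r, x) * block_mat a b n c F $$ (x, k * c + s))"
    using * B by (subst index_mult_mat_sum) (auto simp: block_index_less)
  also have "\<dots> = (\<Sum>l = 0..<a. \<Sum>u = 0..<n.
      (if l = i then B $$ (r, u) * F (int l + 1) (int k + 1) $$ (u, s) else 0))"
    unfolding sum_block_index
    using * B index_kron[of i "1\<^sub>m a" r B]
    by (intro sum.cong refl) (auto simp: index_block_mat)
  also have "\<dots> = (\<Sum>u = 0..<n. B $$ (r, u) * F (int i + 1) (int k + 1) $$ (u, s))"
    using * by (subst sum.swap) simp
  also have "\<dots> = (B * F (int i + 1) (int k + 1)) $$ (r, s)"
    using * B F' by (subst index_mult_mat_sum) auto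
  finally show "((1\<^sub>m a \<otimes>\<^sub>K B) * block_mat a b n c F) $$ (i * dim_row B + r, k * c + s) =
     block_mat a b (dim_row B) c (\<lambda>i k. B * F i k) $$ (i * dim_row B + r, k * c + s)"
    using * by (simp add: index_block_mat)
qed (auto simp: B)

lemma block_mat_mult_kron_one:
  assumes B: "dim_row B = c"
    and F: "\<And>i k. 1 \<le> i \<Longrightarrow> i \<le> int a \<Longrightarrow> 1 \<le> k \<Longrightarrow> k \<le> int b \<Longrightarrow> F i k \<in> carrier_mat n c"
  shows "block_mat a b n c F * (1\<^sub>m b \<otimes>\<^sub>K B) = block_mat a b n (dim_col B) (\<lambda>i k. F i k * B)"
proof -
  \<comment> \<open>reflection turns this into the product on the other side, treated in \<open>kron_one_mult_block_mat\<close>\<close>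
  have "antitr (block_mat a b n c F * (1\<^sub>m b \<otimes>\<^sub>K B)) =
    (1\<^sub>m b \<otimes>\<^sub>K antitr B) * block_mat b a c n (\<lambda>i k. antitr (F (int a + 1 - k) (int b + 1 - i)))"
    using B F by (simp add: antitr_mult antitr_kron antitr_block_mat)
  also have "\<dots> = block_mat b a (dim_col B) n (\<lambda>i k. antitr B * antitr (F (int a + 1 - k) (int b + 1 - i)))"
    using B F[THEN carrier_matD(1)] F[THEN carrier_matD(2)] by (subst kron_one_mult_block_mat) auto
  also have "\<dots> = block_mat b a (dim_col B) n (\<lambda>i k. antitr (F (int a + 1 - k) (int b + 1 - i) * B))"
    using B F[THEN carrier_matD(2)] by (intro block_mat_cong) (auto simp: antitr_mult)
  also have "\<dots> = antitr (block_mat a b n (dim_col B) (\<lambda>i k. F i k * B))"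
    using B F[THEN carrier_matD(1)] by (subst antitr_block_mat) auto
  finally show ?thesis by (metis antitr_antitr)
qed

lemma half_sum_carrier [simp]: "F 0 \<in> carrier_mat n c \<Longrightarrow> half_sum F i \<in> carrier_mat n c"
  by (auto simp: half_sum_def)

lemma dim_half_sum [simp]:
  "dim_row (half_sum F i) = dim_row (F 0)" "dim_col (half_sum F i) = dim_col (F 0)"
  by (auto simp: half_sum_def)

lemma index_half_sum:
  assumes "F 0 \<in> carrier_mat n c" "r < n" "s < c"
  shows "half_sum F i $$ (r, s) = (1/2) * F 0 $$ (r, s) + (\<Sum>j = 1..i - 1. F j $$ (r, s))"
  using assms by (auto simp: half_sum_def)

lemma half_sum_cong:
  assumes "F 0 = G 0" "\<And>s. 0 < s \<Longrightarrow> s < i \<Longrightarrow> F s = G s"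
  shows "half_sum F i = half_sum G i"
  unfolding half_sum_def using assms by (intro cong_mat) auto

lemma half_sum_add:
  assumes "\<And>s. 0 \<le> s \<Longrightarrow> s < i \<Longrightarrow> F s \<in> carrier_mat n c" "\<And>s. 0 \<le> s \<Longrightarrow> s < i \<Longrightarrow> G s \<in> carrier_mat n c"
    and "i \<ge> 1"
  shows "half_sum F i + half_sum G i = half_sum (\<lambda>s. F s + G s) i"
proof (rule eq_matI)
  have F: "F 0 \<in> carrier_mat n c" and G: "G 0 \<in> carrier_mat n c" and FG: "F 0 + G 0 \<in> carrier_mat n c"
    using assms by auto
  fix r s assume "r < dim_row (half_sum (\<lambda>s. F s + G s) i)" "s < dim_col (half_sum (\<lambda>s. F s + G s) i)"
  then have *: "r < n" "s < c" using F G by (auto simp: half_sum_def)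
  have "(half_sum F i + half_sum G i) $$ (r, s) = (1/2) * (F 0 + G 0) $$ (r, s) +
     (\<Sum>j = 1..i - 1. F j $$ (r, s) + G j $$ (r, s))"
    using * F G index_half_sum[of F, OF F] index_half_sum[of G, OF G]
    by (simp add: sum.distrib algebra_simps)
  also have "\<dots> = half_sum (\<lambda>s. F s + G s) i $$ (r, s)"
  proof -
    have "(F j + G j) $$ (r, s) = F j $$ (r, s) + G j $$ (r, s)" if "0 \<le> j" "j < i" for j
      using * carrier_matD[OF assms(2)[OF that]] by simp
    then have "(\<Sum>j = 1..i - 1. F j $$ (r, s) + G j $$ (r, s)) = (\<Sum>j = 1..i - 1. (F j + G j) $$ (r, s))"
      by (intro sum.cong) auto
    then show ?thesis using index_half_sum[of "\<lambda>s. F s + G s" n c r s i] FG * by simp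
  qed
  finally show "(half_sum F i + half_sum G i) $$ (r, s) = half_sum (\<lambda>s. F s + G s) i $$ (r, s)" .
qed (use assms in \<open>auto simp: half_sum_def\<close>)

lemma mult_half_sum:
  assumes "\<And>s. 0 \<le> s \<Longrightarrow> s < i \<Longrightarrow> F s \<in> carrier_mat n c" and "dim_col B = n" and "i \<ge> 1"
  shows "B * half_sum F i = half_sum (\<lambda>s. B * F s) i"
proof (rule eq_matI)
  have F: "F 0 \<in> carrier_mat n c" using assms by auto
  fix r s assume "r < dim_row (half_sum (\<lambda>s. B * F s) i)" "s < dim_col (half_sum (\<lambda>s. B * F s) i)"
  then have *: "r < dim_row B" "s < c" using F by (auto simp: half_sum_def)
  have "(B * half_sum F i) $$ (r, s) =
    (\<Sum>k = 0..<n. B $$ (r, k) * ((1/2) * F 0 $$ (k, s) + (\<Sum>j = 1..i - 1. F j $$ (k, s))))"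
    using * F assms carrier_matD[OF F]
    by (subst index_mult_mat_sum) (auto simp: index_half_sum[of F, OF F])
  also have "\<dots> = (1/2) * (\<Sum>k = 0..<n. B $$ (r, k) * F 0 $$ (k, s)) +
     (\<Sum>j = 1..i - 1. \<Sum>k = 0..<n. B $$ (r, k) * F j $$ (k, s))"
    by (subst sum.swap) (simp add: algebra_simps sum.distrib sum_distrib_left)
  also have "\<dots> = (1/2) * (B * F 0) $$ (r, s) + (\<Sum>j = 1..i - 1. (B * F j) $$ (r, s))"
  proof -
    have "(B * F j) $$ (r, s) = (\<Sum>k = 0..<n. B $$ (r, k) * F j $$ (k, s))" if "0 \<le> j" "j < i" for j
      using assms(1)[OF that] assms(2) * by (subst index_mult_mat_sum) auto
    then show ?thesis using assms(3) by (intro arg_cong2[of _ _ _ _ "(+)"] sum.cong) auto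
  qed
  also have "\<dots> = half_sum (\<lambda>s. B * F s) i $$ (r, s)"
    using * F by (auto simp: half_sum_def)
  finally show "(B * half_sum F i) $$ (r, s) = half_sum (\<lambda>s. B * F s) i $$ (r, s)" .
qed (use assms in \<open>auto simp: half_sum_def\<close>)

lemma antitr_half_sum:
  assumes "\<And>s. 0 \<le> s \<Longrightarrow> s < i \<Longrightarrow> F s \<in> carrier_mat n c" and "i \<ge> 1"
  shows "antitr (half_sum F i) = half_sum (\<lambda>s. antitr (F s)) i"
proof (rule eq_matI)
  have F: "F 0 \<in> carrier_mat n c" using assms by auto
  fix r s assume "r < dim_row (half_sum (\<lambda>s. antitr (F s)) i)" "s < dim_col (half_sum (\<lambda>s. antitr (F s)) i)"
  then have *: "r < c" "s < n" using F by (auto simp: half_sum_def)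
  have "antitr (F j) $$ (r, s) = F j $$ (n - Suc s, c - Suc r)" if "0 \<le> j" "j < i" for j
    using assms(1)[OF that] * by (auto simp: index_antitr)
  then show "antitr (half_sum F i) $$ (r, s) = half_sum (\<lambda>s. antitr (F s)) i $$ (r, s)"
    using * F assms(2) by (auto simp: half_sum_def index_antitr intro!: sum.cong)
qed (use assms in \<open>auto simp: half_sum_def\<close>)

text \<open>
Along row $i$ of a Toeplitz matrix the index $i - k$ runs through $i - a + 1, \dots, i$ (rows
counted from 0); the three terms are the diagonal, the part left of it and the part right of it.
\<close>

lemma sum_toeplitz_row:
  fixes f :: "int \<Rightarrow> complex"
  assumes "i < a"
  shows "(\<Sum>k = 0..<a. f (int i - int k)) =
    f 0 + (\<Sum>s = 1..int i. f s) + (\<Sum>s = 1..int a - int i - 1. f (- s))"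
proof -
  have "(\<Sum>k = 0..<a. f (int i - int k)) = (\<Sum>s \<in> {int i - int a + 1..int i}. f s)"
    by (rule sum.reindex_bij_witness[of _ "\<lambda>s. nat (int i - s)" "\<lambda>k. int i - int k"]) auto
  also have "{int i - int a + 1..int i} = insert 0 ({1..int i} \<union> {int i - int a + 1..- 1})"
    using assms by auto
  also have "sum f \<dots> = f 0 + (sum f {1..int i} + sum f {int i - int a + 1..- 1})"
    by (subst sum.insert, simp, simp, subst sum.union_disjoint) auto
  also have "sum f {int i - int a + 1..- 1} = (\<Sum>s = 1..int a - int i - 1. f (- s))"
    by (rule sum.reindex_bij_witness[of _ uminus uminus]) auto
  finally show ?thesis by (simp add: add.assoc)
qed

text \<open>
The sum of a block row splits at the diagonal block, half of which goes to either side.  Both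
displacement identities and the identity between $K_{11}$ and $K_{12}$ are instances: they use the
blocks $\mathcal T_r$, $t^{(r)}_j$ and $M_{42}^{(r)}$ respectively.
\<close>

lemma block_toeplitz_mult_ones:
  assumes F: "\<And>r. \<bar>r\<bar> < int a \<Longrightarrow> F r \<in> carrier_mat n c"
  shows "block_mat a a n c (\<lambda>i k. F (i - k)) * (ones a \<otimes>\<^sub>K 1\<^sub>m c) =
    block_mat a 1 n c (\<lambda>i _. half_sum F i) +
    block_mat a 1 n c (\<lambda>i _. half_sum (\<lambda>s. F (- s)) (int a + 1 - i))"
proof (rule eq_block_matI[of _ a n _ 1 c])
  have [simp]: "dim_row (ones n) = n" "dim_col (ones n) = 1" for n by (auto simp: ones_def)
  fix i r k s assume *: "i < a" "r < n" "k < (1 :: nat)" "s < c"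
  let ?T = "block_mat a a n c (\<lambda>i k. F (i - k))"
  have F0: "F 0 \<in> carrier_mat n c" using F[of 0] * by auto
  have "(?T * (ones a \<otimes>\<^sub>K 1\<^sub>m c)) $$ (i * n + r, k * c + s) =
    (\<Sum>x = 0..<a * c. ?T $$ (i * n + r, x) * (ones a \<otimes>\<^sub>K 1\<^sub>m c) $$ (x, k * c + s))"
    using * by (subst index_mult_mat_sum) (auto simp: block_index_less)
  also have "\<dots> = (\<Sum>l = 0..<a. \<Sum>u = 0..<c. if u = s then F (int i - int l) $$ (r, u) else 0)"
    unfolding sum_block_index using * index_kron[of _ "ones a" _ "1\<^sub>m c" k s]
    by (intro sum.cong refl) (auto simp: index_block_mat ones_def)
  also have "\<dots> = (\<Sum>l = 0..<a. F (int i - int l) $$ (r, s))"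
    using * by simp
  also have "\<dots> = F 0 $$ (r, s) + (\<Sum>j = 1..int i. F j $$ (r, s)) + (\<Sum>j = 1..int a - int i - 1. F (- j) $$ (r, s))"
    using * by (intro sum_toeplitz_row)
  also have "\<dots> = half_sum F (int i + 1) $$ (r, s) + half_sum (\<lambda>s. F (- s)) (int a - int i) $$ (r, s)"
    using * F0 by (simp add: index_half_sum)
  finally show "(?T * (ones a \<otimes>\<^sub>K 1\<^sub>m c)) $$ (i * n + r, k * c + s) =
    (block_mat a 1 n c (\<lambda>i _. half_sum F i) +
     block_mat a 1 n c (\<lambda>i _. half_sum (\<lambda>s. F (- s)) (int a + 1 - i))) $$ (i * n + r, k * c + s)"
    using * block_index_less[of i a r n] index_block_mat[of i a r n 0 1 s c] by simp
qed (auto simp: ones_def)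

section \<open>Resolvents of the triangular Toeplitz matrices\<close>

lemma dim_A_cal [simp]: "dim_row (A_cal m p) = m p" "dim_col (A_cal m p) = m p"
  by (auto simp: A_cal_def mat1_def)

lemma index_A_cal:
  assumes "j < m p" "l < m p"
  shows "A_cal m p $$ (j, l) = (if j < l then 0 else if j = l then \<i>/2 else \<i>)"
  using assms by (auto simp: A_cal_def mat1_def a_coeff_def)

lemma antitr_A_cal: "antitr (A_cal m p) = A_cal m p"
  by (rule eq_matI) (auto simp: index_antitr index_A_cal)

text \<open>
The diagonal of $\mathcal A_p$ is $\mathrm i/2$, and $\overline{\mathrm i/2} = \mathrm i/2 - \mathrm i$;
below the diagonal the same subtraction gives $0$, above it gives $\overline{\mathrm i}$.
\<close>

lemma mat_adjoint_A_cal: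
  "mat_adjoint (A_cal m p) = A_cal m p - \<i> \<cdot>\<^sub>m (ones (m p) * antitr (ones (m p)))"
proof (rule eq_matI)
  fix i j
  assume "i < dim_row (A_cal m p - \<i> \<cdot>\<^sub>m (ones (m p) * antitr (ones (m p))))"
    "j < dim_col (A_cal m p - \<i> \<cdot>\<^sub>m (ones (m p) * antitr (ones (m p))))"
  then have ij: "i < m p" "j < m p" by auto
  have "(ones (m p) * antitr (ones (m p))) $$ (i, j) = 1"
    using ij by (simp add: index_mult_mat_sum index_antitr ones_def del: index_mult_mat(1))
  then show "mat_adjoint (A_cal m p) $$ (i, j) =
      (A_cal m p - \<i> \<cdot>\<^sub>m (ones (m p) * antitr (ones (m p)))) $$ (i, j)"
    using ij by (cases i j rule: linorder_cases)
      (simp_all add: index_mat_adjoint index_A_cal del: index_mult_mat(1))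
qed auto

lemma resolvent_A_cal:
  fixes m :: "nat \<Rightarrow> nat" and p :: nat and \<mu> :: complex
  assumes "\<mu> \<noteq> \<i>/2"
  defines "P \<equiv> A_cal m p - \<mu> \<cdot>\<^sub>m 1\<^sub>m (m p)"
  shows "mat_inv P \<in> carrier_mat (m p) (m p)" "P * mat_inv P = 1\<^sub>m (m p)" "mat_inv P * P = 1\<^sub>m (m p)"
proof -
  have P: "P \<in> carrier_mat (m p) (m p)" unfolding P_def by auto
  have "det P = prod_list (diag_mat P)"
    by (rule det_lower_triangular[OF _ P]) (auto simp: P_def index_A_cal)
  also have "\<dots> \<noteq> 0"
    using assms(1) by (auto simp: prod_list_zero_iff diag_mat_def P_def index_A_cal)
  finally have "det P \<noteq> 0" .
  then show "mat_inv P \<in> carrier_mat (m p) (m p)" "P * mat_inv P = 1\<^sub>m (m p)" "mat_inv P * P = 1\<^sub>m (m p)"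
    by (rule mat_inv_det[OF P])+
qed

lemma resolvent_adjoint_A_cal:
  fixes m :: "nat \<Rightarrow> nat" and p :: nat and \<mu> :: complex
  assumes "\<mu> \<noteq> - \<i>/2"
  defines "P \<equiv> mat_adjoint (A_cal m p) - \<mu> \<cdot>\<^sub>m 1\<^sub>m (m p)"
  shows "mat_inv P \<in> carrier_mat (m p) (m p)" "P * mat_inv P = 1\<^sub>m (m p)" "mat_inv P * P = 1\<^sub>m (m p)"
proof -
  have P: "P \<in> carrier_mat (m p) (m p)" unfolding P_def by auto
  have "det P = prod_list (diag_mat P)"
    by (rule det_upper_triangular[OF _ P]) (auto simp: P_def index_A_cal index_mat_adjoint upper_triangular_def)
  also have "\<dots> \<noteq> 0"
  proof -
    have "cnj (\<i>/2) - \<mu> \<noteq> 0" using assms(1) by simp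
    moreover have "P $$ (j, j) = cnj (\<i>/2) - \<mu>" if "j < m p" for j
      unfolding P_def using that by (simp add: index_A_cal index_mat_adjoint)
    ultimately show ?thesis using P by (auto simp: prod_list_zero_iff diag_mat_def)
  qed
  finally have "det P \<noteq> 0" .
  then show "mat_inv P \<in> carrier_mat (m p) (m p)" "P * mat_inv P = 1\<^sub>m (m p)" "mat_inv P * P = 1\<^sub>m (m p)"
    by (rule mat_inv_det[OF P])+
qed

text \<open>
A finite geometric series with ratio $y = (\mu + \mathrm i/2)/(\mu - \mathrm i/2)$; the factor
$\mathrm i$ disappears since $y - 1 = \mathrm i/(\mu - \mathrm i/2)$.
\<close>

lemma resolvent_ones_sum:
  fixes \<mu> :: complex
  assumes \<mu>: "\<mu> \<noteq> \<i>/2"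
  shows "\<i> * (\<Sum>l = 0..<j. - (((\<mu> + \<i>/2) / (\<mu> - \<i>/2)) ^ l) / (\<mu> - \<i>/2)) = 1 - ((\<mu> + \<i>/2) / (\<mu> - \<i>/2)) ^ j"
proof -
  define d where "d = \<mu> - \<i>/2"
  define y where "y = (\<mu> + \<i>/2) / d"
  have d: "d \<noteq> 0" using \<mu> by (simp add: d_def)
  have "\<mu> + \<i>/2 = d + \<i>" by (simp add: d_def)
  then have y: "y - 1 = \<i> / d" using d by (simp add: y_def add_divide_distrib)
  have "(\<Sum>l = 0..<j. - (y ^ l) / d) = (\<Sum>l<j. y ^ l) * (- 1 / d)"
    unfolding sum_distrib_right atLeast0LessThan by (intro sum.cong) auto
  then have "\<i> * (\<Sum>l = 0..<j. - (y ^ l) / d) = - ((y - 1) * (\<Sum>l<j. y ^ l))"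
    unfolding y by simp
  also have "\<dots> = 1 - y ^ j"
    by (subst power_diff_1_eq[symmetric]) simp
  finally show ?thesis by (simp only: y_def d_def)
qed

text \<open>
Subtracting consecutive rows of $(\mathcal A_p - \mu) w = \mathbf 1$ shows that the quotient of
neighbouring entries of $w$ is $(\mu + \mathrm i/2)/(\mu - \mathrm i/2)$.  The proof checks that the
resulting geometric progression solves the system.
\<close>

lemma resolvent_ones:
  fixes \<mu> :: complex
  assumes \<mu>: "\<mu> \<noteq> \<i>/2"
  shows "mat_inv (A_cal m p - \<mu> \<cdot>\<^sub>m 1\<^sub>m (m p)) * ones (m p) =
    mat (m p) 1 (\<lambda>(j, _). - (((\<mu> + \<i>/2) / (\<mu> - \<i>/2)) ^ j) / (\<mu> - \<i>/2))" (is "mat_inv ?P * _ = ?w")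
proof -
  let ?y = "(\<mu> + \<i>/2) / (\<mu> - \<i>/2)"
  have "?P * ?w = ones (m p)"
  proof (rule eq_matI)
    fix j l assume "j < dim_row (ones (m p))" "l < dim_col (ones (m p))"
    then have j: "j < m p" and l: "l = 0" by auto
    have "(?P * ?w) $$ (j, l) = (\<Sum>k = 0..<m p. ?P $$ (j, k) * (- (?y ^ k) / (\<mu> - \<i>/2)))"
      using j l by (simp add: index_mult_mat_sum del: index_mult_mat(1))
    also have "\<dots> = (\<Sum>k = 0..<Suc j. ?P $$ (j, k) * (- (?y ^ k) / (\<mu> - \<i>/2)))"
      using j by (intro sum.mono_neutral_right) (auto simp: index_A_cal)
    also have "\<dots> = \<i> * (\<Sum>k = 0..<j. - (?y ^ k) / (\<mu> - \<i>/2)) + (\<i>/2 - \<mu>) * (- (?y ^ j) / (\<mu> - \<i>/2))"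
      using j by (simp add: index_A_cal sum_distrib_left)
    also have "\<dots> = 1"
    proof -
    have "e * (- c / d) = c" if "d \<noteq> 0" "e = - d" for c d e :: complex using that by simp
    then have "(\<i>/2 - \<mu>) * (- (?y ^ j) / (\<mu> - \<i>/2)) = ?y ^ j"
      using \<mu> by (metis eq_iff_diff_eq_0 minus_diff_eq)
    then show ?thesis unfolding resolvent_ones_sum[OF \<mu>] by (simp only: diff_add_cancel)
  qed
    finally show "(?P * ?w) $$ (j, l) = ones (m p) $$ (j, l)"
      using j l by (simp add: ones_def)
  qed auto
  then have "mat_inv ?P * ones (m p) = mat_inv ?P * (?P * ?w)" by simp
  also have "\<dots> = (mat_inv ?P * ?P) * ?w"
    using resolvent_A_cal(1)[OF \<mu>, of m p] by (subst mult_mat_assoc_dim) auto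
  also have "\<dots> = ?w" using resolvent_A_cal(3)[OF \<mu>, of m p] by simp
  finally show ?thesis .
qed

lemma sum_resolvent_ones:
  fixes \<mu> :: complex
  assumes \<mu>: "\<mu> \<noteq> \<i>/2"
  shows "antitr (mat_inv (A_cal m p - \<mu> \<cdot>\<^sub>m 1\<^sub>m (m p)) * ones (m p)) * ones (m p) =
    (- \<i> * (1 - ((\<mu> + \<i>/2) / (\<mu> - \<i>/2)) ^ m p)) \<cdot>\<^sub>m 1\<^sub>m 1"
proof (rule eq_matI)
  let ?y = "(\<mu> + \<i>/2) / (\<mu> - \<i>/2)"
  fix i j assume "i < dim_row ((- \<i> * (1 - ?y ^ m p)) \<cdot>\<^sub>m 1\<^sub>m 1)" "j < dim_col ((- \<i> * (1 - ?y ^ m p)) \<cdot>\<^sub>m 1\<^sub>m 1)"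
  then have ij: "i = 0" "j = 0" by auto
  have "(antitr (mat_inv (A_cal m p - \<mu> \<cdot>\<^sub>m 1\<^sub>m (m p)) * ones (m p)) * ones (m p)) $$ (i, j) =
     (\<Sum>k = 0..<m p. - (?y ^ (m p - Suc k)) / (\<mu> - \<i>/2))"
    unfolding resolvent_ones[OF \<mu>] ij
    by (simp add: index_mult_mat_sum index_antitr ones_def del: index_mult_mat(1))
  also have "\<dots> = (\<Sum>k = 0..<m p. - (?y ^ k) / (\<mu> - \<i>/2))"
    by (rule sum.reindex_bij_witness[of _ "\<lambda>k. m p - Suc k" "\<lambda>k. m p - Suc k"]) auto
  also have "\<dots> = - \<i> * (\<i> * (\<Sum>k = 0..<m p. - (?y ^ k) / (\<mu> - \<i>/2)))"
    by (simp only: mult.assoc[symmetric] minus_mult_left[symmetric] i_squared) (simp only: minus_minus mult_1)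
  also have "\<dots> = - \<i> * (1 - ?y ^ m p)" unfolding resolvent_ones_sum[OF \<mu>] ..
  finally show "(antitr (mat_inv (A_cal m p - \<mu> \<cdot>\<^sub>m 1\<^sub>m (m p)) * ones (m p)) * ones (m p)) $$ (i, j) =
     ((- \<i> * (1 - ?y ^ m p)) \<cdot>\<^sub>m 1\<^sub>m 1) $$ (i, j)" using ij by simp
qed auto

text \<open>
With $P = \mathcal A_p - \mu$ and $w = P^{-1} \mathbf 1$, reflection of $P w = \mathbf 1$ gives
$w^\sharp P = \mathbf 1^*$, since $P$ is Toeplitz.  The rank one perturbation
$Q = P - \mathrm i\, \mathbf 1 \mathbf 1^*$ then satisfies
$w^\sharp Q = (1 - \mathrm i\, w^\sharp \mathbf 1)\, \mathbf 1^*$, and the scalar equals $z^{-m_p}$ by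
\<open>sum_resolvent_ones\<close>.  This is where the factors of $q$ come from.
\<close>

lemma ones_resolvent_adjoint:
  fixes \<mu> :: complex
  assumes \<mu>: "\<mu> \<noteq> \<i>/2" "\<mu> \<noteq> - \<i>/2"
  defines "z \<equiv> (\<mu> - \<i>/2) / (\<mu> + \<i>/2)"
  shows "antitr (ones (m p)) * mat_inv (mat_adjoint (A_cal m p) - \<mu> \<cdot>\<^sub>m 1\<^sub>m (m p)) =
     z ^ m p \<cdot>\<^sub>m antitr (mat_inv (A_cal m p - \<mu> \<cdot>\<^sub>m 1\<^sub>m (m p)) * ones (m p))"
proof -
  define e where "e = ones (m p)"
  define P where "P = A_cal m p - \<mu> \<cdot>\<^sub>m 1\<^sub>m (m p)"
  define Q where "Q = mat_adjoint (A_cal m p) - \<mu> \<cdot>\<^sub>m 1\<^sub>m (m p)"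
  define w where "w = mat_inv P * e"
  note P = resolvent_A_cal[OF \<mu>(1), of m p, folded P_def]
  note Q = resolvent_adjoint_A_cal[OF \<mu>(2), of m p, folded Q_def]
  have [simp]: "dim_row P = m p" "dim_col P = m p" "dim_row Q = m p" "dim_col Q = m p"
    "dim_row e = m p" "dim_col e = 1" "dim_row (mat_inv P) = m p" "dim_col (mat_inv P) = m p"
    "dim_row (mat_inv Q) = m p" "dim_col (mat_inv Q) = m p" "dim_row w = m p" "dim_col w = 1"
    using P(1) Q(1) by (auto simp: P_def Q_def e_def w_def)
  have QP: "Q = P - \<i> \<cdot>\<^sub>m (e * antitr e)"
    unfolding P_def Q_def e_def mat_adjoint_A_cal by (rule eq_matI) auto
  have "P * w = e" using P by (simp add: w_def flip: mult_mat_assoc_dim)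
  moreover have "antitr P = P"
    unfolding P_def by (simp add: antitr_diff antitr_smult antitr_A_cal)
  ultimately have wP: "antitr w * P = antitr e" by (metis antitr_mult \<open>dim_col P = m p\<close> \<open>dim_row w = m p\<close>)
  have "antitr w * e = (- \<i> * (1 - inverse z ^ m p)) \<cdot>\<^sub>m 1\<^sub>m 1"
    unfolding w_def e_def P_def sum_resolvent_ones[OF \<mu>(1)] z_def by simp
  then have "antitr w * (e * antitr e) = (- \<i> * (1 - inverse z ^ m p)) \<cdot>\<^sub>m antitr e"
    by (simp add: smult_mult_mat_dim flip: mult_mat_assoc_dim)
  then have "antitr w * Q = antitr e - \<i> \<cdot>\<^sub>m ((- \<i> * (1 - inverse z ^ m p)) \<cdot>\<^sub>m antitr e)"
    unfolding QP by (simp add: mult_mat_diff_dim wP mult_smult_mat_dim)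
  also have "\<dots> = inverse z ^ m p \<cdot>\<^sub>m antitr e"
    by (rule eq_matI) (auto simp: algebra_simps)
  finally have wQ: "antitr w * Q = inverse z ^ m p \<cdot>\<^sub>m antitr e" .
  have "\<mu> + \<i>/2 \<noteq> 0" using \<mu>(2) by (metis eq_neg_iff_add_eq_0 minus_divide_left)
  then have z: "z \<noteq> 0" using \<mu>(1) by (simp add: z_def)
  have zz: "z ^ n * (inverse z ^ n * c) = c" for n and c :: complex
    using z by (simp add: power_inverse)
  have "z ^ m p \<cdot>\<^sub>m antitr w = z ^ m p \<cdot>\<^sub>m (antitr w * (Q * mat_inv Q))"
    using Q by simp
  also have "\<dots> = z ^ m p \<cdot>\<^sub>m (inverse z ^ m p \<cdot>\<^sub>m (antitr e * mat_inv Q))"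
    by (simp add: wQ smult_mult_mat_dim flip: mult_mat_assoc_dim)
  also have "\<dots> = antitr e * mat_inv Q"
    by (intro eq_matI) (simp_all add: zz del: index_mult_mat(1))
  finally show ?thesis by (simp add: w_def e_def P_def Q_def)
qed

definition w_col :: "(nat \<Rightarrow> nat) \<Rightarrow> (nat \<Rightarrow> complex) \<Rightarrow> nat \<Rightarrow> complex mat" where
  "w_col m \<mu> p = mat_inv (A_cal m p - \<mu> p \<cdot>\<^sub>m 1\<^sub>m (m p)) * ones (m p)"

text \<open>
The $p$-th factor of $q(\mu)$.
\<close>

definition cayley_pow :: "(nat \<Rightarrow> nat) \<Rightarrow> (nat \<Rightarrow> complex) \<Rightarrow> nat \<Rightarrow> complex" where
  "cayley_pow m \<mu> p = ((\<mu> p - \<i>/2) / (\<mu> p + \<i>/2)) ^ m p"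

lemma w_col_carrier:
  assumes "\<mu> p \<noteq> \<i>/2"
  shows "dim_row (w_col m \<mu> p) = m p" "dim_col (w_col m \<mu> p) = 1"
  using resolvent_A_cal(1)[OF assms, of m p] by (auto simp: w_col_def)

lemma ones_resolvent_w_col:
  assumes "\<mu> p \<noteq> \<i>/2" "\<mu> p \<noteq> - \<i>/2"
  shows "antitr (ones (m p)) * mat_inv (mat_adjoint (A_cal m p) - \<mu> p \<cdot>\<^sub>m 1\<^sub>m (m p)) =
    cayley_pow m \<mu> p \<cdot>\<^sub>m antitr (w_col m \<mu> p)"
  using ones_resolvent_adjoint[OF assms] by (simp add: w_col_def cayley_pow_def)

lemma w_col_sum:
  assumes "\<mu> p \<noteq> \<i>/2" "\<mu> p \<noteq> - \<i>/2"
  obtains s where "antitr (w_col m \<mu> p) * ones (m p) = s \<cdot>\<^sub>m 1\<^sub>m 1"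
    "cayley_pow m \<mu> p * s = \<i> * (1 - cayley_pow m \<mu> p)"
proof
  let ?z = "(\<mu> p - \<i>/2) / (\<mu> p + \<i>/2)" and ?y = "(\<mu> p + \<i>/2) / (\<mu> p - \<i>/2)"
  have "\<mu> p + \<i>/2 \<noteq> 0" using assms(2) by (metis eq_neg_iff_add_eq_0 minus_divide_left)
  then have "?z * ?y = 1" using assms(1) by simp
  then have "?z ^ m p * ?y ^ m p = 1" by (metis power_mult_distrib power_one)
  then show "cayley_pow m \<mu> p * (- \<i> * (1 - ?y ^ m p)) = \<i> * (1 - cayley_pow m \<mu> p)"
    unfolding cayley_pow_def by (simp only: right_diff_distrib mult_1_right mult.left_commute) simp
  show "antitr (w_col m \<mu> p) * ones (m p) = (- \<i> * (1 - ?y ^ m p)) \<cdot>\<^sub>m 1\<^sub>m 1"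
    unfolding w_col_def by (rule sum_resolvent_ones[OF assms(1)])
qed

section \<open>Products of the resolvents of the two Kronecker factors\<close>

text \<open>
The column $(A_1 - \mu_1)^{-1} (A_2 - \mu_2)^{-1} \mathcal L$ in factored form, see
\<open>resolvents_L_mat\<close>.
\<close>

definition W_mat :: "(nat \<Rightarrow> nat) \<Rightarrow> (nat \<Rightarrow> complex) \<Rightarrow> complex mat" where
  "W_mat m \<mu> = w_col m \<mu> 1 \<otimes>\<^sub>K w_col m \<mu> 2 \<otimes>\<^sub>K 1\<^sub>m (m 3)"

lemma resolvents_L_mat:
  fixes m :: "nat \<Rightarrow> nat" and \<mu> :: "nat \<Rightarrow> complex"
  assumes "\<mu> 1 \<noteq> \<i>/2" "\<mu> 2 \<noteq> \<i>/2"
  defines "I \<equiv> 1\<^sub>m (m 1 * m 2 * m 3)"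
  shows "mat_inv (A_mat m 1 - \<mu> 1 \<cdot>\<^sub>m I) * mat_inv (A_mat m 2 - \<mu> 2 \<cdot>\<^sub>m I) * L_mat m = W_mat m \<mu>"
    "mat_inv (A_mat m 1 - \<mu> 1 \<cdot>\<^sub>m I) * mat_inv (A_mat m 2 - \<mu> 2 \<cdot>\<^sub>m I) \<in>
      carrier_mat (m 1 * (m 2 * m 3)) (m 1 * (m 2 * m 3))"
proof -
  let ?R = "\<lambda>p. mat_inv (A_cal m p - \<mu> p \<cdot>\<^sub>m 1\<^sub>m (m p))"
  note R1 = resolvent_A_cal[OF assms(1), of m 1] and R2 = resolvent_A_cal[OF assms(2), of m 2]
  have L: "L_mat m = ones (m 1) \<otimes>\<^sub>K ones (m 2) \<otimes>\<^sub>K 1\<^sub>m (m 3)"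
    by (simp add: L_mat_def kron_ones)
  have "mat_inv (A_mat m 1 - \<mu> 1 \<cdot>\<^sub>m I) = ?R 1 \<otimes>\<^sub>K 1\<^sub>m (m 2) \<otimes>\<^sub>K 1\<^sub>m (m 3)"
    unfolding I_def A_mat_def if_P[OF refl] using R1(1,2)
    by (intro mat_inv_kron_shift_left) (auto intro: carrier_matI)
  moreover have "mat_inv (A_mat m 2 - \<mu> 2 \<cdot>\<^sub>m I) = 1\<^sub>m (m 1) \<otimes>\<^sub>K ?R 2 \<otimes>\<^sub>K 1\<^sub>m (m 3)"
  proof -
    have "A_mat m 2 = 1\<^sub>m (m 1) \<otimes>\<^sub>K A_cal m 2 \<otimes>\<^sub>K 1\<^sub>m (m 3)" by (simp add: A_mat_def)
    then show ?thesis unfolding I_def using R2(1,2)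
      by (simp only:) (intro mat_inv_kron_shift_middle, auto intro: carrier_matI)
  qed
  ultimately have prod: "mat_inv (A_mat m 1 - \<mu> 1 \<cdot>\<^sub>m I) * mat_inv (A_mat m 2 - \<mu> 2 \<cdot>\<^sub>m I) =
      ?R 1 \<otimes>\<^sub>K ?R 2 \<otimes>\<^sub>K 1\<^sub>m (m 3)"
    by (simp only: kron_commuting_factors[OF R1(1) R2(1)])
  note dims = carrier_matD[OF R1(1)] carrier_matD[OF R2(1)]
  show "mat_inv (A_mat m 1 - \<mu> 1 \<cdot>\<^sub>m I) * mat_inv (A_mat m 2 - \<mu> 2 \<cdot>\<^sub>m I) * L_mat m = W_mat m \<mu>"
    unfolding prod L W_mat_def w_col_def by (rule kron_kron_one_mult) (simp_all only: dims dim_ones)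
  show "mat_inv (A_mat m 1 - \<mu> 1 \<cdot>\<^sub>m I) * mat_inv (A_mat m 2 - \<mu> 2 \<cdot>\<^sub>m I) \<in>
      carrier_mat (m 1 * (m 2 * m 3)) (m 1 * (m 2 * m 3))"
    unfolding prod by (rule carrier_matI) (simp_all only: dim_kron dims index_one_mat mult.assoc)
qed

text \<open>
Each tensor factor contributes one factor of $q$ by \<open>ones_resolvent_w_col\<close>; on the third
factor the reflection fixes the identity.
\<close>

lemma L_mat_adjoint_resolvents:
  fixes m :: "nat \<Rightarrow> nat" and \<mu> :: "nat \<Rightarrow> complex"
  assumes "\<mu> 1 \<noteq> \<i>/2" "\<mu> 2 \<noteq> \<i>/2" "\<mu> 1 \<noteq> - \<i>/2" "\<mu> 2 \<noteq> - \<i>/2"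
  defines "I \<equiv> 1\<^sub>m (m 1 * m 2 * m 3)"
  shows "mat_adjoint (L_mat m) * (mat_inv (mat_adjoint (A_mat m 1) - \<mu> 1 \<cdot>\<^sub>m I) *
      mat_inv (mat_adjoint (A_mat m 2) - \<mu> 2 \<cdot>\<^sub>m I)) = q_fun m \<mu> \<cdot>\<^sub>m antitr (W_mat m \<mu>)"
proof -
  let ?R = "\<lambda>p. mat_inv (mat_adjoint (A_cal m p) - \<mu> p \<cdot>\<^sub>m 1\<^sub>m (m p))"
  note R1 = resolvent_adjoint_A_cal[OF assms(3), of m 1]
    and R2 = resolvent_adjoint_A_cal[OF assms(4), of m 2]
  have L: "mat_adjoint (L_mat m) = antitr (ones (m 1)) \<otimes>\<^sub>K antitr (ones (m 2)) \<otimes>\<^sub>K 1\<^sub>m (m 3)"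
    by (simp add: L_mat_def kron_ones[symmetric] mat_adjoint_kron mat_adjoint_ones)
  have "mat_inv (mat_adjoint (A_mat m 1) - \<mu> 1 \<cdot>\<^sub>m I) = ?R 1 \<otimes>\<^sub>K 1\<^sub>m (m 2) \<otimes>\<^sub>K 1\<^sub>m (m 3)"
    unfolding I_def A_mat_def if_P[OF refl] mat_adjoint_kron mat_adjoint_one using R1(1,2)
    by (intro mat_inv_kron_shift_left) (auto intro: carrier_matI)
  moreover have "mat_inv (mat_adjoint (A_mat m 2) - \<mu> 2 \<cdot>\<^sub>m I) = 1\<^sub>m (m 1) \<otimes>\<^sub>K ?R 2 \<otimes>\<^sub>K 1\<^sub>m (m 3)"
  proof -
    have "mat_adjoint (A_mat m 2) = 1\<^sub>m (m 1) \<otimes>\<^sub>K mat_adjoint (A_cal m 2) \<otimes>\<^sub>K 1\<^sub>m (m 3)"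
      by (simp add: A_mat_def mat_adjoint_kron)
    then show ?thesis unfolding I_def using R2(1,2)
      by (simp only:) (intro mat_inv_kron_shift_middle, auto intro: carrier_matI)
  qed
  ultimately have prod: "mat_inv (mat_adjoint (A_mat m 1) - \<mu> 1 \<cdot>\<^sub>m I) *
      mat_inv (mat_adjoint (A_mat m 2) - \<mu> 2 \<cdot>\<^sub>m I) = ?R 1 \<otimes>\<^sub>K ?R 2 \<otimes>\<^sub>K 1\<^sub>m (m 3)"
    by (simp only: kron_commuting_factors[OF R1(1) R2(1)])
  have "mat_adjoint (L_mat m) * (mat_inv (mat_adjoint (A_mat m 1) - \<mu> 1 \<cdot>\<^sub>m I) *
      mat_inv (mat_adjoint (A_mat m 2) - \<mu> 2 \<cdot>\<^sub>m I)) =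
    (antitr (ones (m 1)) * ?R 1) \<otimes>\<^sub>K (antitr (ones (m 2)) * ?R 2) \<otimes>\<^sub>K 1\<^sub>m (m 3)"
    unfolding prod L
    by (rule kron_kron_one_mult) (simp_all only: dim_ones dim_antitr carrier_matD[OF R1(1)] carrier_matD[OF R2(1)])
  also have "\<dots> = q_fun m \<mu> \<cdot>\<^sub>m antitr (W_mat m \<mu>)"
    unfolding ones_resolvent_w_col[of \<mu> 1, OF assms(1,3)] ones_resolvent_w_col[of \<mu> 2, OF assms(2,4)]
      W_mat_def antitr_kron antitr_one kron_smult_left kron_smult_right
    by (intro eq_matI) (simp_all add: q_fun_def cayley_pow_def)
  finally show ?thesis .
qed

section \<open>Kronecker form of the constant displacement factors\<close>

lemma M21_kron: "M21 m = antitr (ones (m 1)) \<otimes>\<^sub>K 1\<^sub>m (m 2 * m 3)"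
  by (simp add: M21_def mat_adjoint_ones)

lemma M31_kron: "M31 m = ones (m 1) \<otimes>\<^sub>K 1\<^sub>m (m 2 * m 3)"
  by (simp add: M31_def M21_kron mat_adjoint_kron mat_adjoint_antitr_ones)

lemma M22_kron: "M22 m = 1\<^sub>m (m 1) \<otimes>\<^sub>K (antitr (ones (m 2)) \<otimes>\<^sub>K 1\<^sub>m (m 3))"
  by (simp add: M22_def mat_adjoint_ones kron_assoc)

lemma M32_kron: "M32 m = 1\<^sub>m (m 1) \<otimes>\<^sub>K (ones (m 2) \<otimes>\<^sub>K 1\<^sub>m (m 3))"
  by (simp add: M32_def M22_kron mat_adjoint_kron mat_adjoint_antitr_ones)

lemma antitr_M21: "antitr (M21 m) = M31 m"
  by (simp add: M21_kron M31_kron antitr_kron)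

lemma antitr_M22: "antitr (M22 m) = M32 m"
  by (simp add: M22_kron M32_kron antitr_kron)

lemma L_part_mult_adjoint:
  "L_part m p * mat_adjoint (L_part m k) = ones (m p) \<otimes>\<^sub>K (antitr (ones (m k)) \<otimes>\<^sub>K 1\<^sub>m (m 3))"
  by (simp add: L_part_def mat_adjoint_kron mat_adjoint_ones kron_mult kron_col_row flip: kron_assoc)

lemma M22_mult_M31: "M22 m * M31 m = L_part m 1 * mat_adjoint (L_part m 2)"
  by (simp add: M22_kron M31_kron L_part_mult_adjoint kron_mult left_mult_one_mat' right_mult_one_mat')

lemma antitr_L_part_mult_adjoint:
  "antitr (L_part m 1 * mat_adjoint (L_part m 2)) = L_part m 2 * mat_adjoint (L_part m 1)"
  by (simp add: L_part_def mat_adjoint_kron mat_adjoint_ones antitr_mult antitr_kron)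

text \<open>
The factor $\mathbf 1$ in $M_{31}$ meets the first tensor factor, whose sum is known, and leaves the
second factor untouched.
\<close>

lemma W_mat_mult_M31:
  assumes "\<mu> 1 \<noteq> \<i>/2" "\<mu> 2 \<noteq> \<i>/2" "\<mu> 1 \<noteq> - \<i>/2"
  shows "(q_fun m \<mu> \<cdot>\<^sub>m antitr (W_mat m \<mu>)) * M31 m = (\<i> * (1 - cayley_pow m \<mu> 1)) \<cdot>\<^sub>m
    (cayley_pow m \<mu> 2 \<cdot>\<^sub>m antitr (w_col m \<mu> 2 \<otimes>\<^sub>K 1\<^sub>m (m 3)))"
proof -
  note [simp] = w_col_carrier[of \<mu>, OF assms(1)] w_col_carrier[of \<mu>, OF assms(2)]
  obtain s where s: "antitr (w_col m \<mu> 1) * ones (m 1) = s \<cdot>\<^sub>m 1\<^sub>m 1"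
    "cayley_pow m \<mu> 1 * s = \<i> * (1 - cayley_pow m \<mu> 1)"
    using w_col_sum[of \<mu> 1, OF assms(1,3)] by metis
  have "antitr (W_mat m \<mu>) * M31 m = s \<cdot>\<^sub>m antitr (w_col m \<mu> 2 \<otimes>\<^sub>K 1\<^sub>m (m 3))"
    unfolding W_mat_def M31_kron antitr_kron kron_one[symmetric] kron_assoc
    by (simp add: kron_mult s(1) kron_smult_left left_mult_one_mat' right_mult_one_mat' kron_one
        del: One_nat_def)
  moreover have "q_fun m \<mu> * s = (cayley_pow m \<mu> 1 * s) * cayley_pow m \<mu> 2"
    by (simp only: q_fun_def cayley_pow_def mult_ac)
  then have "q_fun m \<mu> * s = (\<i> * (1 - cayley_pow m \<mu> 1)) * cayley_pow m \<mu> 2"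
    by (simp only: s(2))
  moreover have "dim_col (antitr (W_mat m \<mu>)) = dim_row (M31 m)"
    by (simp add: W_mat_def M31_kron mult.assoc del: One_nat_def)
  ultimately show ?thesis by (rule smult_mult_smult)
qed

lemma W_mat_mult_M32:
  assumes "\<mu> 1 \<noteq> \<i>/2" "\<mu> 2 \<noteq> \<i>/2" "\<mu> 2 \<noteq> - \<i>/2"
  shows "(q_fun m \<mu> \<cdot>\<^sub>m antitr (W_mat m \<mu>)) * M32 m = (\<i> * (1 - cayley_pow m \<mu> 2)) \<cdot>\<^sub>m
    (cayley_pow m \<mu> 1 \<cdot>\<^sub>m antitr (w_col m \<mu> 1 \<otimes>\<^sub>K 1\<^sub>m (m 3)))"
proof -
  note [simp] = w_col_carrier[of \<mu>, OF assms(1)] w_col_carrier[of \<mu>, OF assms(2)]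
  obtain s where s: "antitr (w_col m \<mu> 2) * ones (m 2) = s \<cdot>\<^sub>m 1\<^sub>m 1"
    "cayley_pow m \<mu> 2 * s = \<i> * (1 - cayley_pow m \<mu> 2)"
    using w_col_sum[of \<mu> 2, OF assms(2,3)] by metis
  have "antitr (W_mat m \<mu>) * M32 m = s \<cdot>\<^sub>m antitr (w_col m \<mu> 1 \<otimes>\<^sub>K 1\<^sub>m (m 3))"
    unfolding W_mat_def M32_kron antitr_kron kron_assoc
    by (simp add: kron_mult s(1) kron_smult_left kron_smult_right left_mult_one_mat' right_mult_one_mat'
        del: One_nat_def)
  moreover have "q_fun m \<mu> * s = (cayley_pow m \<mu> 2 * s) * cayley_pow m \<mu> 1"
    by (simp only: q_fun_def cayley_pow_def mult_ac)
  then have "q_fun m \<mu> * s = (\<i> * (1 - cayley_pow m \<mu> 2)) * cayley_pow m \<mu> 1"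
    by (simp only: s(2))
  moreover have "dim_col (antitr (W_mat m \<mu>)) = dim_row (M32 m)"
    by (simp add: W_mat_def M32_kron mult.assoc del: One_nat_def)
  ultimately show ?thesis by (rule smult_mult_smult)
qed

section \<open>The symmetries as consequences of the displacement identities\<close>

lemma dim_append_rows [simp]:
  "dim_row (A @\<^sub>r B) = dim_row A + dim_row B" "dim_col (A @\<^sub>r B) = dim_col A"
  by (auto simp: append_rows_def)

lemma dim_append_cols [simp]:
  "dim_row (A @\<^sub>c B) = dim_row A" "dim_col (A @\<^sub>c B) = dim_col A + dim_col B"
  by (auto simp: append_cols_def)

lemma index_append_rows:
  assumes "i < dim_row A + dim_row B" "j < dim_col A" "dim_col A = dim_col B"
  shows "(A @\<^sub>r B) $$ (i, j) = (if i < dim_row A then A $$ (i, j) else B $$ (i - dim_row A, j))"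
  using assms by (auto simp: append_rows_def)

lemma index_append_cols:
  assumes "i < dim_row A" "j < dim_col A + dim_col B" "dim_row A = dim_row B"
  shows "(A @\<^sub>c B) $$ (i, j) = (if j < dim_col A then A $$ (i, j) else B $$ (i, j - dim_col A))"
  using assms by (auto simp: append_cols_def index_append_rows)

lemma mult_append_cols:
  assumes "dim_col M = dim_row A" "dim_row A = dim_row B"
  shows "M * (A @\<^sub>c B) = (M * A) @\<^sub>c (M * B)"
  using assms
  by (intro eq_matI)
    (auto simp: index_append_cols index_mult_mat_sum simp del: index_mult_mat(1))

lemma append_rows_mult:
  assumes "dim_col A = dim_row M" "dim_col A = dim_col B"
  shows "(A @\<^sub>r B) * M = (A * M) @\<^sub>r (B * M)"
  using assms
  by (intro eq_matI)
    (auto simp: index_append_rows index_mult_mat_sum simp del: index_mult_mat(1))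

lemma append_cols_append_rows:
  assumes "dim_row A = dim_row B" "dim_row C = dim_row D" "dim_col A = dim_col C" "dim_col B = dim_col D"
  shows "(A @\<^sub>r C) @\<^sub>c (B @\<^sub>r D) = four_block_mat A B C D"
  using assms by (intro eq_matI) (auto simp: index_append_rows index_append_cols)

text \<open>
A block column times a block row, in the form in which $\widehat\Pi_k R\, \Pi_p$ occurs in
$G_{12}$ and $G_{21}$.
\<close>

lemma append_rows_mult_append_cols:
  assumes "dim_col A = dim_row C" "dim_col A = dim_col B" "dim_row C = dim_row D"
  shows "(A @\<^sub>r B) * (C @\<^sub>c D) = four_block_mat (A * C) (A * D) (B * C) (B * D)"
  using assms by (simp add: append_rows_mult mult_append_cols append_cols_append_rows)

lemma U_tilde_exchange:
  "U_tilde m k = four_block_mat (0\<^sub>m (m k * m 3) (m k * m 3)) (- exchange (m k * m 3))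
     (exchange (m k * m 3)) (0\<^sub>m (m k * m 3) (m k * m 3))"
  by (simp add: U_tilde_def U_mat_exchange kron_exchange Let_def)

text \<open>
The transposition lays the two blocks side by side, $\widetilde U_k$ swaps them with a sign, and the
exchange matrices turn the transposed blocks into reflected ones.
\<close>

lemma exchange_transpose_append_rows_U_tilde:
  assumes a: "a \<in> carrier_mat (m k * m 3) e" and b: "b \<in> carrier_mat (m k * m 3) e"
  shows "exchange e * (a @\<^sub>r b)\<^sup>T * U_tilde m k = antitr b @\<^sub>c (- antitr a)"
proof (rule eq_matI)
  let ?d = "m k * m 3"
  note [simp] = carrier_matD[OF a] carrier_matD[OF b]
  fix i j assume "i < dim_row (antitr b @\<^sub>c (- antitr a))" "j < dim_col (antitr b @\<^sub>c (- antitr a))"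
  then have i: "i < e" and j: "j < ?d + ?d" by auto
  let ?X = "(a @\<^sub>r b)\<^sup>T"
  have X: "?X = a\<^sup>T @\<^sub>c b\<^sup>T" by (simp add: append_cols_def)
  have U: "U_tilde m k = (0\<^sub>m ?d ?d @\<^sub>r exchange ?d) @\<^sub>c (- exchange ?d @\<^sub>r 0\<^sub>m ?d ?d)"
    unfolding U_tilde_exchange by (simp add: append_cols_append_rows)
  have "?X * (A @\<^sub>r B) = a\<^sup>T * A + b\<^sup>T * B" if "A \<in> carrier_mat ?d f" "B \<in> carrier_mat ?d f" for A B f
  proof (rule eq_matI)
    fix i j assume "i < dim_row (a\<^sup>T * A + b\<^sup>T * B)" "j < dim_col (a\<^sup>T * A + b\<^sup>T * B)"
    then have "i < e" "j < f" using that by auto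
    then have "(?X * (A @\<^sub>r B)) $$ (i, j) = (\<Sum>k = 0..<?d + ?d. ?X $$ (i, k) * (A @\<^sub>r B) $$ (k, j))"
      using that by (subst index_mult_mat_sum) auto
    also have "\<dots> = (\<Sum>k = 0..<?d. ?X $$ (i, k) * (A @\<^sub>r B) $$ (k, j)) +
      (\<Sum>k = 0..<?d. ?X $$ (i, k + ?d) * (A @\<^sub>r B) $$ (k + ?d, j))"
      by (simp add: sum.atLeastLessThan_concat[symmetric, of 0 ?d "?d + ?d"]
        sum.shift_bounds_nat_ivl[of _ 0 ?d ?d, simplified])
    also have "\<dots> = (a\<^sup>T * A + b\<^sup>T * B) $$ (i, j)"
      using that \<open>i < e\<close> \<open>j < f\<close>
      by (simp add: index_mult_mat_sum X index_append_cols index_append_rows del: index_mult_mat(1))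
    finally show "(?X * (A @\<^sub>r B)) $$ (i, j) = (a\<^sup>T * A + b\<^sup>T * B) $$ (i, j)" .
  qed (use that in \<open>auto simp: X\<close>)
  from this[of "0\<^sub>m ?d ?d" ?d "exchange ?d"] this[of "- exchange ?d" ?d "0\<^sub>m ?d ?d"]
  have "?X * U_tilde m k = (b\<^sup>T * exchange ?d) @\<^sub>c (- (a\<^sup>T * exchange ?d))"
    unfolding U by (simp add: mult_append_cols X carrier_matI)
  then have "exchange e * ?X * U_tilde m k =
      (exchange e * (b\<^sup>T * exchange ?d)) @\<^sub>c (exchange e * (- (a\<^sup>T * exchange ?d)))"
    by (simp add: mult_mat_assoc_dim mult_append_cols U_tilde_exchange)
  also have "\<dots> = antitr b @\<^sub>c (- antitr a)"
    using exchange_transpose_exchange[of a] exchange_transpose_exchange[of b]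
    by (simp add: mult_mat_assoc_dim)
  finally show "(exchange e * ?X * U_tilde m k) $$ (i, j) = (antitr b @\<^sub>c (- antitr a)) $$ (i, j)" by simp
qed (use assms in \<open>auto simp: U_tilde_exchange\<close>)

lemma U_tilde_transpose_U_tilde:
  assumes "a \<in> carrier_mat (m p * m 3) (m k * m 3)" "b \<in> carrier_mat (m p * m 3) (m k * m 3)"
    "c \<in> carrier_mat (m p * m 3) (m k * m 3)" "d \<in> carrier_mat (m p * m 3) (m k * m 3)"
  shows "U_tilde m k * (four_block_mat a b c d)\<^sup>T * U_tilde m p =
    four_block_mat (- antitr d) (antitr b) (antitr c) (- antitr a)"
proof -
  let ?E = "m k * m 3" and ?D = "m p * m 3"
  note dims = assms[THEN carrier_matD(1)] assms[THEN carrier_matD(2)]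
  have 1: "U_tilde m k * (four_block_mat a b c d)\<^sup>T =
    four_block_mat (- (exchange ?E * b\<^sup>T)) (- (exchange ?E * d\<^sup>T)) (exchange ?E * a\<^sup>T) (exchange ?E * c\<^sup>T)"
    unfolding U_tilde_exchange transpose_four_block_mat[OF assms]
    by (subst mult_four_block_mat[of _ ?E ?E _ ?E _ ?E _ _ ?D _ ?D])
      (use assms in \<open>auto simp: dims\<close>)
  have "U_tilde m k * (four_block_mat a b c d)\<^sup>T * U_tilde m p = four_block_mat
     (- (exchange ?E * d\<^sup>T * exchange ?D)) (exchange ?E * b\<^sup>T * exchange ?D)
     (exchange ?E * c\<^sup>T * exchange ?D) (- (exchange ?E * a\<^sup>T * exchange ?D))"
    unfolding 1 unfolding U_tilde_exchange
    by (subst mult_four_block_mat[of _ ?E ?D _ ?D _ ?E _ _ ?D _ ?D])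
      (use assms in \<open>auto simp: dims\<close>)
  then show ?thesis
    using exchange_transpose_exchange[of a] exchange_transpose_exchange[of b]
      exchange_transpose_exchange[of c] exchange_transpose_exchange[of d] by (simp add: dims)
qed

text \<open>
Here \<open>W\<close> stands for the resolvents applied to $\mathcal L$ and \<open>y\<close> for the
column in the correction term of $\widehat u_p$.  Both sides are pairs of blocks.  The second blocks
agree by $M_2^\sharp = M_3$ and $R^\sharp = R$.  In the first blocks $R M_4^\sharp = M_3 - R M_1$ produces the extra
term $q W^\sharp M_3$, which the hypothesis on it balances against the correction terms:
$\mathrm i (1 - z_p) + \mathrm i z_p = \mathrm i$.
\<close>

lemma u_from_displacement:
  fixes R M1 M2 M3 M4 W y :: "complex mat"
  assumes carr: "T \<in> carrier_mat n n" "R \<in> carrier_mat n n" "M1 \<in> carrier_mat n d" "M3 \<in> carrier_mat n d"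
     "M2 \<in> carrier_mat d n" "M4 \<in> carrier_mat d n" "W \<in> carrier_mat n e" "y \<in> carrier_mat d e"
   and d: "d = m k * m 3"
   and RT: "R * T = 1\<^sub>m n" and R: "antitr R = R"
   and M13: "M1 + antitr M4 = T * M3" and M23: "antitr M2 = M3"
   and WM: "(q \<cdot>\<^sub>m antitr W) * M3 = (\<i> * (1 - zp)) \<cdot>\<^sub>m (zk \<cdot>\<^sub>m antitr y)" and q: "q = zp * zk"
  shows "(q \<cdot>\<^sub>m antitr W) * (R * (M1 @\<^sub>c M3)) - \<i> \<cdot>\<^sub>m ((zk \<cdot>\<^sub>m antitr y) * (1\<^sub>m d @\<^sub>c 0\<^sub>m d d)) =
    - (q \<cdot>\<^sub>m (exchange e * (((M2 @\<^sub>r M4) * R) * W + \<i> \<cdot>\<^sub>m ((0\<^sub>m d d @\<^sub>r 1\<^sub>m d) * y))\<^sup>T * U_tilde m k))"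
proof -
  note dims [simp] = carr[THEN carrier_matD(1)] carr[THEN carrier_matD(2)]
  define X where "X = q \<cdot>\<^sub>m antitr W"
  define \<xi> where "\<xi> = zk \<cdot>\<^sub>m antitr y"
  have [simp]: "dim_row X = e" "dim_col X = n" "dim_row \<xi> = e" "dim_col \<xi> = d"
    by (auto simp: X_def \<xi>_def)
  have M4: "antitr M4 = T * M3 - M1"
    by (subst diff_eq_if_add_eq[of "antitr M4" M1]) (auto simp flip: M13 intro!: eq_matI)
  have "((M2 @\<^sub>r M4) * R) * W + \<i> \<cdot>\<^sub>m ((0\<^sub>m d d @\<^sub>r 1\<^sub>m d) * y) =
    (M2 * R * W) @\<^sub>r (M4 * R * W + \<i> \<cdot>\<^sub>m y)"
    by (simp add: append_rows_mult left_mult_one_mat')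
      (rule eq_matI, auto simp: index_append_rows simp del: index_mult_mat(1))
  then have "exchange e * (((M2 @\<^sub>r M4) * R) * W + \<i> \<cdot>\<^sub>m ((0\<^sub>m d d @\<^sub>r 1\<^sub>m d) * y))\<^sup>T * U_tilde m k =
    antitr (M4 * R * W + \<i> \<cdot>\<^sub>m y) @\<^sub>c (- antitr (M2 * R * W))"
    using d by (simp add: exchange_transpose_append_rows_U_tilde carrier_matI)
  also have "antitr (M2 * R * W) = antitr W * (R * M3)"
    by (simp add: antitr_mult R M23)
  also have "antitr (M4 * R * W + \<i> \<cdot>\<^sub>m y) = antitr W * (R * antitr M4) + \<i> \<cdot>\<^sub>m antitr y"
    by (simp add: antitr_add antitr_smult antitr_mult R)
  also have "R * antitr M4 = M3 - R * M1"
    by (simp add: M4 mult_mat_diff_dim RT left_mult_one_mat' flip: mult_mat_assoc_dim)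
  finally have rhs: "exchange e * (((M2 @\<^sub>r M4) * R) * W + \<i> \<cdot>\<^sub>m ((0\<^sub>m d d @\<^sub>r 1\<^sub>m d) * y))\<^sup>T * U_tilde m k =
    (antitr W * (M3 - R * M1) + \<i> \<cdot>\<^sub>m antitr y) @\<^sub>c (- (antitr W * (R * M3)))" .
  have lhs: "X * (R * (M1 @\<^sub>c M3)) - \<i> \<cdot>\<^sub>m (\<xi> * (1\<^sub>m d @\<^sub>c 0\<^sub>m d d)) =
     (X * (R * M1) - \<i> \<cdot>\<^sub>m \<xi>) @\<^sub>c (X * (R * M3))"
    by (simp add: mult_append_cols right_mult_one_mat')
      (rule eq_matI, auto simp: index_append_cols simp del: index_mult_mat(1))
  have "- (q \<cdot>\<^sub>m ((antitr W * (M3 - R * M1) + \<i> \<cdot>\<^sub>m antitr y) @\<^sub>c (- (antitr W * (R * M3))))) =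
    (X * (R * M1) - (X * M3 + (\<i> * zp) \<cdot>\<^sub>m \<xi>)) @\<^sub>c (X * (R * M3))"
    by (rule eq_matI)
      (auto simp: index_append_cols X_def \<xi>_def q smult_mult_mat_dim mult_mat_diff_dim algebra_simps
        simp del: index_mult_mat(1))
  also have "X * M3 + (\<i> * zp) \<cdot>\<^sub>m \<xi> = \<i> \<cdot>\<^sub>m \<xi>"
    unfolding WM[folded X_def \<xi>_def] by (rule eq_matI) (auto simp: algebra_simps)
  finally show ?thesis
    unfolding rhs lhs[unfolded X_def \<xi>_def] by (simp add: X_def \<xi>_def)
qed

lemma four_block_mat_diff:
  assumes "dim_row A = dim_row A'" "dim_col A = dim_col A'"
    "dim_row D = dim_row D'" "dim_col D = dim_col D'"
    "dim_row B = dim_row A" "dim_row B' = dim_row A" "dim_col B = dim_col D" "dim_col B' = dim_col D"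
    "dim_row C = dim_row D" "dim_row C' = dim_row D" "dim_col C = dim_col A" "dim_col C' = dim_col A"
  shows "four_block_mat A B C D - four_block_mat A' B' C' D' =
    four_block_mat (A - A') (B - B') (C - C') (D - (D' :: complex mat))"
  using assms by (intro eq_matI) auto

text \<open>
The variables \<open>Nij\<close>, \<open>L11\<close>, \<open>L12\<close> stand for $M_{ij}$, $K_{11}$, $K_{12}$.  By
\<open>U_tilde_transpose_U_tilde\<close> the claim compares four blocks.  The upper right one
follows from $M_{2p}^\sharp = M_{3p}$ and $R^\sharp = R$; the others use
$R M_{41}^\sharp = M_{31} - R M_{11}$ or its mirror image $M_{12}^\sharp R = M_{22} - M_{42} R$.  The terms
without $R$ cancel against the subtracted constants: in the two diagonal blocks because
\<open>Y\<close>, which is $\mathcal L_1 \mathcal L_2^*$ in the application, equals $M_{22} M_{31}$, and in the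
lower left block by the identity between $K_{11}$ and $K_{12}$.
\<close>

lemma G_21_from_displacement:
  fixes m :: "nat \<Rightarrow> nat"
  defines "D \<equiv> m 2 * m 3" and "E \<equiv> m 1 * m 3"
  assumes carr: "T \<in> carrier_mat n n" "R \<in> carrier_mat n n"
     "N11 \<in> carrier_mat n D" "N31 \<in> carrier_mat n D" "N21 \<in> carrier_mat D n" "N41 \<in> carrier_mat D n"
     "N12 \<in> carrier_mat n E" "N32 \<in> carrier_mat n E" "N22 \<in> carrier_mat E n" "N42 \<in> carrier_mat E n"
     "L11 \<in> carrier_mat E D" "L12 \<in> carrier_mat D E" "Y \<in> carrier_mat E D"
   and RT: "R * T = 1\<^sub>m n" and TR: "T * R = 1\<^sub>m n" and R: "antitr R = R" and T: "antitr T = T"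
   and M1: "N11 + antitr N41 = T * N31" "antitr N21 = N31"
   and M2: "N12 + antitr N42 = T * N32" "antitr N22 = N32"
   and K: "L11 + N22 * antitr N41 = antitr L12 + N42 * N31"
   and Y: "N22 * N31 = Y"
  shows "\<i> \<cdot>\<^sub>m ((N22 @\<^sub>r N42) * (R * (N11 @\<^sub>c N31)) - four_block_mat Y (0\<^sub>m E D) L11 (0\<^sub>m E D)) =
    U_tilde m 1 * (\<i> \<cdot>\<^sub>m ((N21 @\<^sub>r N41) * (R * (N12 @\<^sub>c N32)) -
      four_block_mat (antitr Y) (0\<^sub>m D E) L12 (0\<^sub>m D E)))\<^sup>T * U_tilde m 2"
proof -
  note dims [simp] = carr[THEN carrier_matD(1)] carr[THEN carrier_matD(2)]
  have N41: "antitr N41 = T * N31 - N11"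
    by (subst diff_eq_if_add_eq[of "antitr N41" N11]) (auto simp flip: M1(1) intro!: eq_matI)
  have "N12 = T * N32 - antitr N42"
    by (rule diff_eq_if_add_eq[OF M2(1)]) auto
  then have N12: "antitr N12 = N22 * T - N42"
    by (simp add: antitr_diff antitr_mult T flip: M2(2))
  have N22: "antitr N32 = N22" and N21: "antitr N31 = N21" by (simp_all flip: M1(2) M2(2))
  have L11: "L11 = antitr L12 + N42 * N31 - N22 * antitr N41"
    by (rule diff_eq_if_add_eq[OF K]) auto
  have N12R: "antitr N12 * R = N22 - N42 * R"
    by (simp add: N12 diff_mult_mat_dim mult_mat_assoc_dim TR right_mult_one_mat')
  have RM41: "R * antitr N41 = N31 - R * N11"
    by (simp add: N41 mult_mat_diff_dim RT left_mult_one_mat' flip: mult_mat_assoc_dim)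
  define a b c d where "a = N21 * (R * N12) - antitr Y" and "b = N21 * (R * N32)"
    and "c = N41 * (R * N12) - L12" and "d = N41 * (R * N32)"
  have abcd: "a \<in> carrier_mat D E" "b \<in> carrier_mat D E" "c \<in> carrier_mat D E" "d \<in> carrier_mat D E"
    by (auto simp: a_def b_def c_def d_def)
  note [simp] = abcd[THEN carrier_matD(1)] abcd[THEN carrier_matD(2)]
  have a: "- antitr a = N42 * (R * N31)"
  proof -
    have "antitr a = antitr N12 * R * N31 - Y"
      by (simp add: a_def antitr_diff antitr_mult R M1(2))
    also have "antitr N12 * R * N31 = Y - N42 * (R * N31)"
      unfolding N12R by (simp add: diff_mult_mat_dim mult_mat_assoc_dim Y)
    finally show ?thesis by (intro eq_matI) (auto simp del: index_mult_mat(1))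
  qed
  have d: "- antitr d = N22 * (R * N11) - Y"
  proof -
    have "antitr d = N22 * (R * antitr N41)"
      by (simp add: d_def antitr_mult R N22 mult_mat_assoc_dim)
    also have "\<dots> = Y - N22 * (R * N11)"
      unfolding RM41 by (simp add: mult_mat_diff_dim Y)
    finally show ?thesis by (intro eq_matI) (auto simp del: index_mult_mat(1))
  qed
  have b: "antitr b = N22 * (R * N31)"
    by (simp add: b_def antitr_mult R N22 M1(2) mult_mat_assoc_dim)
  have c: "antitr c = N42 * (R * N11) - L11"
  proof -
    have "antitr c = antitr N12 * R * antitr N41 - antitr L12"
      by (simp add: c_def antitr_diff antitr_mult R)
    also have "antitr N12 * R * antitr N41 = N22 * antitr N41 - N42 * (R * antitr N41)"
      unfolding N12R by (simp add: diff_mult_mat_dim mult_mat_assoc_dim)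
    also have "N42 * (R * antitr N41) = N42 * N31 - N42 * (R * N11)"
      unfolding RM41 by (simp add: mult_mat_diff_dim)
    finally show ?thesis
      unfolding L11 by (auto intro!: eq_matI simp del: index_mult_mat(1))
  qed
  have "(N21 @\<^sub>r N41) * (R * (N12 @\<^sub>c N32)) - four_block_mat (antitr Y) (0\<^sub>m D E) L12 (0\<^sub>m D E) =
    four_block_mat a b c d"
    by (simp add: mult_append_cols[of R] append_rows_mult_append_cols four_block_mat_diff)
      (auto simp: a_def b_def c_def d_def intro!: cong_four_block_mat eq_matI simp del: index_mult_mat(1))
  then have "U_tilde m 1 * (\<i> \<cdot>\<^sub>m ((N21 @\<^sub>r N41) * (R * (N12 @\<^sub>c N32)) -
      four_block_mat (antitr Y) (0\<^sub>m D E) L12 (0\<^sub>m D E)))\<^sup>T * U_tilde m 2 =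
    U_tilde m 1 * (four_block_mat (\<i> \<cdot>\<^sub>m a) (\<i> \<cdot>\<^sub>m b) (\<i> \<cdot>\<^sub>m c) (\<i> \<cdot>\<^sub>m d))\<^sup>T * U_tilde m 2"
    using abcd by (simp add: smult_four_block_mat)
  also have "\<dots> = four_block_mat (- antitr (\<i> \<cdot>\<^sub>m d)) (antitr (\<i> \<cdot>\<^sub>m b)) (antitr (\<i> \<cdot>\<^sub>m c)) (- antitr (\<i> \<cdot>\<^sub>m a))"
    using abcd unfolding D_def E_def by (intro U_tilde_transpose_U_tilde) auto
  also have "\<dots> = \<i> \<cdot>\<^sub>m four_block_mat (- antitr d) (antitr b) (antitr c) (- antitr a)"
    by (rule eq_matI) (auto simp: antitr_smult)
  also have "four_block_mat (- antitr d) (antitr b) (antitr c) (- antitr a) =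
    (N22 @\<^sub>r N42) * (R * (N11 @\<^sub>c N31)) - four_block_mat Y (0\<^sub>m E D) L11 (0\<^sub>m E D)"
    unfolding a b c d
    by (simp add: mult_append_cols[of R] append_rows_mult_append_cols four_block_mat_diff)
      (auto intro!: cong_four_block_mat eq_matI simp del: index_mult_mat(1))
  finally show ?thesis ..
qed

section \<open>Displacement identities of a DSTU block matrix\<close>

locale dstu =
  fixes m :: "nat \<Rightarrow> nat" and t :: blocks
  assumes m1: "m 1 > 0" and m2: "m 2 > 0"
    and t_carrier: "\<And>r j. \<bar>r\<bar> < int (m 1) \<Longrightarrow> \<bar>j\<bar> < int (m 2) \<Longrightarrow> t r j \<in> carrier_mat (m 3) (m 3)"
    and t_flip: "\<And>r j. \<bar>r\<bar> < int (m 1) \<Longrightarrow> \<bar>j\<bar> < int (m 2) \<Longrightarrow>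
      U_mat m 3 * t r j * U_mat m 3 = (t r j)\<^sup>T"
begin

text \<open>
The condition $U_3 t\, U_3 = t^\tau$ becomes $t^\sharp = t$ after multiplication with $U_3$ on both
sides.
\<close>

lemma antitr_t:
  assumes "\<bar>r\<bar> < int (m 1)" "\<bar>j\<bar> < int (m 2)"
  shows "antitr (t r j) = t r j"
proof -
  note [simp] = carrier_matD[OF t_carrier[OF assms]]
  have "antitr (t r j) = exchange (m 3) * (exchange (m 3) * t r j * exchange (m 3)) * exchange (m 3)"
    using exchange_transpose_exchange[of "t r j"] t_flip[OF assms] by (simp add: U_mat_exchange)
  also have "\<dots> = (exchange (m 3) * exchange (m 3)) * (t r j * (exchange (m 3) * exchange (m 3)))"
    by (simp add: mult_mat_assoc_dim)
  also have "\<dots> = t r j"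
    by (simp add: exchange_exchange left_mult_one_mat' right_mult_one_mat')
  finally show ?thesis .
qed

lemma T_cal_carrier: "T_cal m t r \<in> carrier_mat (m 2 * m 3) (m 2 * m 3)"
  by (rule carrier_matI) (simp_all add: T_cal_def)

lemma antitr_T_cal:
  assumes "\<bar>r\<bar> < int (m 1)"
  shows "antitr (T_cal m t r) = T_cal m t r"
proof -
  have "antitr (T_cal m t r) = block_mat (m 2) (m 2) (m 3) (m 3)
      (\<lambda>i k. antitr (t r ((int (m 2) + 1 - k) - (int (m 2) + 1 - i))))"
    unfolding T_cal_def using assms by (intro antitr_block_mat t_carrier) auto
  also have "\<dots> = T_cal m t r"
    unfolding T_cal_def using assms by (intro block_mat_cong) (auto simp: antitr_t)
  finally show ?thesis .
qed

lemma antitr_tbt_mat: "antitr (tbt_mat m t) = tbt_mat m t"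
proof -
  have "antitr (tbt_mat m t) = block_mat (m 1) (m 1) (m 2 * m 3) (m 2 * m 3)
      (\<lambda>i k. antitr (T_cal m t ((int (m 1) + 1 - k) - (int (m 1) + 1 - i))))"
    unfolding tbt_mat_def by (intro antitr_block_mat T_cal_carrier)
  also have "\<dots> = tbt_mat m t"
    unfolding tbt_mat_def by (intro block_mat_cong) (auto simp: antitr_T_cal)
  finally show ?thesis .
qed

text \<open>
Each half sum is fixed by the reflection, only their order is reversed.  Together with
\<open>block_toeplitz_mult_ones\<close> this gives the first displacement identity.
\<close>

lemma antitr_M41:
  "antitr (M41 m t) = block_mat (m 1) 1 (m 2 * m 3) (m 2 * m 3)
     (\<lambda>i _. half_sum (\<lambda>s. T_cal m t (- s)) (int (m 1) + 1 - i))"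
proof -
  have "antitr (M41 m t) = block_mat (m 1) 1 (m 2 * m 3) (m 2 * m 3)
      (\<lambda>i _. antitr (half_sum (\<lambda>s. T_cal m t (- s)) (int (m 1) + 1 - i)))"
    unfolding M41_def by (subst antitr_block_mat) (auto intro!: half_sum_carrier T_cal_carrier)
  also have "\<dots> = block_mat (m 1) 1 (m 2 * m 3) (m 2 * m 3)
     (\<lambda>i _. half_sum (\<lambda>s. T_cal m t (- s)) (int (m 1) + 1 - i))"
  proof (rule block_mat_cong)
    fix i k :: int assume i: "1 \<le> i" "i \<le> int (m 1)"
    have "antitr (half_sum (\<lambda>s. T_cal m t (- s)) (int (m 1) + 1 - i)) =
      half_sum (\<lambda>s. antitr (T_cal m t (- s))) (int (m 1) + 1 - i)"
      using i by (intro antitr_half_sum[where n = "m 2 * m 3" and c = "m 2 * m 3"] T_cal_carrier) auto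
    also have "\<dots> = half_sum (\<lambda>s. T_cal m t (- s)) (int (m 1) + 1 - i)"
      using i by (intro half_sum_cong) (auto simp: antitr_T_cal)
    finally show "antitr (half_sum (\<lambda>s. T_cal m t (- s)) (int (m 1) + 1 - i)) =
      half_sum (\<lambda>s. T_cal m t (- s)) (int (m 1) + 1 - i)" .
  qed
  finally show ?thesis .
qed

lemma M11_add_antitr_M41: "M11 m t + antitr (M41 m t) = tbt_mat m t * M31 m"
  unfolding antitr_M41 M31_kron M11_def tbt_mat_def
  by (subst block_toeplitz_mult_ones) (auto intro!: T_cal_carrier)

lemma M12_part_carrier:
  "\<bar>r\<bar> < int (m 1) \<Longrightarrow> M12_part m t r \<in> carrier_mat (m 2 * m 3) (m 3)"
  by (rule carrier_matI) (simp_all add: M12_part_def)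

lemma M42_part_carrier:
  "\<bar>r\<bar> < int (m 1) \<Longrightarrow> M42_part m t r \<in> carrier_mat (m 3) (m 2 * m 3)"
  by (rule carrier_matI) (simp_all add: M42_part_def)

lemma antitr_M42_part:
  assumes r: "\<bar>r\<bar> < int (m 1)"
  shows "antitr (M42_part m t r) = block_mat (m 2) 1 (m 3) (m 3)
     (\<lambda>i _. half_sum (\<lambda>s. t r (- s)) (int (m 2) + 1 - i))"
proof -
  have "antitr (M42_part m t r) = block_mat (m 2) 1 (m 3) (m 3)
      (\<lambda>i _. antitr (half_sum (\<lambda>s. t r (- s)) (int (m 2) + 1 - i)))"
    unfolding M42_part_def using r m2
    by (subst antitr_block_mat) (auto intro!: half_sum_carrier t_carrier)
  also have "\<dots> = block_mat (m 2) 1 (m 3) (m 3)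
     (\<lambda>i _. half_sum (\<lambda>s. t r (- s)) (int (m 2) + 1 - i))"
  proof (rule block_mat_cong)
    fix i k :: int assume i: "1 \<le> i" "i \<le> int (m 2)"
    have "antitr (half_sum (\<lambda>s. t r (- s)) (int (m 2) + 1 - i)) =
      half_sum (\<lambda>s. antitr (t r (- s))) (int (m 2) + 1 - i)"
      using i r by (intro antitr_half_sum[where n = "m 3" and c = "m 3"] t_carrier) auto
    also have "\<dots> = half_sum (\<lambda>s. t r (- s)) (int (m 2) + 1 - i)"
      using i r m2 by (intro half_sum_cong) (auto simp: antitr_t)
    finally show "antitr (half_sum (\<lambda>s. t r (- s)) (int (m 2) + 1 - i)) =
      half_sum (\<lambda>s. t r (- s)) (int (m 2) + 1 - i)" .
  qed
  finally show ?thesis .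
qed

text \<open>
The one-level identity again, now inside the block $\mathcal T_r$.
\<close>

lemma M12_part_add_antitr_M42_part:
  assumes r: "\<bar>r\<bar> < int (m 1)"
  shows "M12_part m t r + antitr (M42_part m t r) = T_cal m t r * (ones (m 2) \<otimes>\<^sub>K 1\<^sub>m (m 3))"
  unfolding antitr_M42_part[OF r] M12_part_def T_cal_def using r
  by (subst block_toeplitz_mult_ones) (auto intro!: t_carrier)

text \<open>
The mirror image of the previous identity; it uses $\mathcal T_r^\sharp = \mathcal T_r$.
\<close>

lemma antitr_M12_part_add_M42_part:
  assumes r: "\<bar>r\<bar> < int (m 1)"
  shows "antitr (M12_part m t r) + M42_part m t r = (antitr (ones (m 2)) \<otimes>\<^sub>K 1\<^sub>m (m 3)) * T_cal m t r"
proof -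
  note [simp] = carrier_matD[OF M12_part_carrier[OF r]] carrier_matD[OF M42_part_carrier[OF r]]
    carrier_matD[OF T_cal_carrier]
  have "antitr (M12_part m t r + antitr (M42_part m t r)) = antitr (M12_part m t r) + M42_part m t r"
    by (simp add: antitr_add)
  moreover have "antitr (T_cal m t r * (ones (m 2) \<otimes>\<^sub>K 1\<^sub>m (m 3))) =
      (antitr (ones (m 2)) \<otimes>\<^sub>K 1\<^sub>m (m 3)) * T_cal m t r"
    by (simp add: antitr_mult antitr_kron antitr_T_cal[OF r])
  ultimately show ?thesis by (simp add: M12_part_add_antitr_M42_part[OF r])
qed

lemma M12_add_antitr_M42: "M12 m t + antitr (M42 m t) = tbt_mat m t * M32 m"
proof -
  have "antitr (M42 m t) = block_mat (m 1) (m 1) (m 2 * m 3) (m 3)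
      (\<lambda>i k. antitr (M42_part m t (i - k)))"
    unfolding M42_def by (subst antitr_block_mat) (auto intro!: M42_part_carrier)
  then have "M12 m t + antitr (M42 m t) = block_mat (m 1) (m 1) (m 2 * m 3) (m 3)
      (\<lambda>i k. M12_part m t (i - k) + antitr (M42_part m t (i - k)))"
    unfolding M12_def
    by (simp, subst block_mat_add) (auto intro!: carrier_matI simp: M42_part_def)
  also have "\<dots> = block_mat (m 1) (m 1) (m 2 * m 3) (m 3)
      (\<lambda>i k. T_cal m t (i - k) * (ones (m 2) \<otimes>\<^sub>K 1\<^sub>m (m 3)))"
    by (intro block_mat_cong M12_part_add_antitr_M42_part) auto
  also have "\<dots> = tbt_mat m t * M32 m"
    unfolding tbt_mat_def M32_kron by (subst block_mat_mult_kron_one) (auto intro!: T_cal_carrier)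
  finally show ?thesis .
qed

lemma antitr_K12:
  "antitr (K12 m t) = block_mat (m 1) 1 (m 3) (m 2 * m 3)
     (\<lambda>i _. half_sum (\<lambda>s. antitr (M12_part m t (- s))) (int (m 1) + 1 - i))"
proof -
  have "antitr (K12 m t) = block_mat (m 1) 1 (m 3) (m 2 * m 3)
      (\<lambda>i _. antitr (half_sum (\<lambda>s. M12_part m t (- s)) (int (m 1) + 1 - i)))"
    unfolding K12_def using m1
    by (subst antitr_block_mat) (auto intro!: half_sum_carrier M12_part_carrier)
  also have "\<dots> = block_mat (m 1) 1 (m 3) (m 2 * m 3)
     (\<lambda>i _. half_sum (\<lambda>s. antitr (M12_part m t (- s))) (int (m 1) + 1 - i))"
    by (intro block_mat_cong antitr_half_sum[where n = "m 2 * m 3" and c = "m 3"] M12_part_carrier) auto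
  finally show ?thesis .
qed

text \<open>
Both sides equal $K_{11}$ plus two reversed columns of half sums, one formed from the blocks
$(M_{12}^{(r)})^\sharp$ and one from the $M_{42}^{(r)}$.  On the left they arise because
$\mathbf 1^* \otimes I$ maps $\mathcal T_r$ to $(M_{12}^{(r)})^\sharp + M_{42}^{(r)}$; on the right the
first is $K_{12}^\sharp$ and the second comes from splitting the row sums of $M_{42}$.
\<close>

lemma K11_add_M22_mult_antitr_M41:
  "K11 m t + M22 m * antitr (M41 m t) = antitr (K12 m t) + M42 m t * M31 m"
proof -
  let ?c = "\<lambda>F. block_mat (m 1) 1 (m 3) (m 2 * m 3) (\<lambda>i _. half_sum (\<lambda>s. F (- s)) (int (m 1) + 1 - i))"
  let ?B = "antitr (ones (m 2)) \<otimes>\<^sub>K 1\<^sub>m (m 3)"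
  have "M22 m * antitr (M41 m t) = block_mat (m 1) 1 (m 3) (m 2 * m 3)
     (\<lambda>i _. ?B * half_sum (\<lambda>s. T_cal m t (- s)) (int (m 1) + 1 - i))"
    unfolding M22_kron antitr_M41
    by (subst kron_one_mult_block_mat) (auto intro!: half_sum_carrier T_cal_carrier)
  also have "\<dots> = block_mat (m 1) 1 (m 3) (m 2 * m 3)
     (\<lambda>i _. half_sum (\<lambda>s. antitr (M12_part m t (- s))) (int (m 1) + 1 - i) +
            half_sum (\<lambda>s. M42_part m t (- s)) (int (m 1) + 1 - i))"
  proof (rule block_mat_cong)
    fix i k :: int assume i: "1 \<le> i" "i \<le> int (m 1)"
    let ?i = "int (m 1) + 1 - i"
    have "?B * half_sum (\<lambda>s. T_cal m t (- s)) ?i = half_sum (\<lambda>s. ?B * T_cal m t (- s)) ?i"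
      using i by (intro mult_half_sum[OF T_cal_carrier]) auto
    also have "\<dots> = half_sum (\<lambda>s. antitr (M12_part m t (- s)) + M42_part m t (- s)) ?i"
      using i m1 by (intro half_sum_cong antitr_M12_part_add_M42_part[symmetric]) auto
    also have "\<dots> = half_sum (\<lambda>s. antitr (M12_part m t (- s))) ?i + half_sum (\<lambda>s. M42_part m t (- s)) ?i"
      using i by (intro half_sum_add[symmetric, of _ _ "m 3" "m 2 * m 3"])
        (auto intro!: carrier_matI simp: M12_part_def M42_part_def)
    finally show "?B * half_sum (\<lambda>s. T_cal m t (- s)) ?i =
      half_sum (\<lambda>s. antitr (M12_part m t (- s))) ?i + half_sum (\<lambda>s. M42_part m t (- s)) ?i" .
  qed
  also have "\<dots> = antitr (K12 m t) + ?c (M42_part m t)"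
    unfolding antitr_K12 using m1 by (intro block_mat_add[symmetric] half_sum_carrier M42_part_carrier) auto
  finally have "M22 m * antitr (M41 m t) = antitr (K12 m t) + ?c (M42_part m t)" .
  moreover have "M42 m t * M31 m = K11 m t + ?c (M42_part m t)"
    unfolding M42_def M31_kron K11_def
    by (subst block_toeplitz_mult_ones) (auto intro!: M42_part_carrier)
  ultimately show ?thesis
    by (auto intro!: eq_matI simp: K11_def K12_def simp del: index_mult_mat(1))
qed

end

theorem theorem4p1:
  fixes m :: "nat \<Rightarrow> nat" and t :: "int \<Rightarrow> int \<Rightarrow> complex mat"
  assumes "m 1 \<ge> 2" and "m 2 \<ge> 2" and "m 3 \<ge> 2"
    and "\<And>r j. \<bar>r\<bar> < int (m 1) \<Longrightarrow> \<bar>j\<bar> < int (m 2) \<Longrightarrow> t r j \<in> carrier_mat (m 3) (m 3)"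
    and "invertible_mat (tbt_mat m t)"
    and "\<And>r j. \<bar>r\<bar> < int (m 1) \<Longrightarrow> \<bar>j\<bar> < int (m 2) \<Longrightarrow>
           U_mat m 3 * t r j * U_mat m 3 = (t r j)\<^sup>T"
  shows "(\<forall>k\<in>{1, 2}. \<forall>p\<in>{1, 2}. k \<noteq> p \<longrightarrow>
            (\<forall>\<mu> :: nat \<Rightarrow> complex. \<mu> 1 \<notin> {\<i>/2, - \<i>/2} \<and> \<mu> 2 \<notin> {\<i>/2, - \<i>/2} \<longrightarrow>
               u_fun m t p \<mu> = - (q_fun m \<mu> \<cdot>\<^sub>m (U_mat m 3 * (u_hat_fun m t p \<mu>)\<^sup>T * U_tilde m k))))
       \<and> G21 m t = U_tilde m 1 * (G12 m t)\<^sup>T * U_tilde m 2"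
proof -
  interpret dstu m t using assms by unfold_locales auto
  let ?T = "tbt_mat m t" and ?n = "m 1 * (m 2 * m 3)"
  define R where "R = mat_inv ?T"
  have T: "?T \<in> carrier_mat ?n ?n" by (rule carrier_matI) (simp_all add: tbt_mat_def)
  note R = mat_inv_invertible[OF T assms(5), folded R_def]
  have antitr_R: "antitr R = R"
  proof -
    note [simp] = carrier_matD[OF R(1)] carrier_matD[OF T]
    have "antitr (?T * R) = 1\<^sub>m ?n" by (simp add: R(2))
    then have "antitr R * ?T = 1\<^sub>m ?n" by (simp add: antitr_mult antitr_tbt_mat)
    \<comment> \<open>both the reflection of \<open>R\<close> and \<open>R\<close> invert the matrix, one from each side\<close>
    then have "antitr R * (?T * R) = R"
      by (simp add: left_mult_one_mat' flip: mult_mat_assoc_dim)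
    then show ?thesis by (simp add: R(2) right_mult_one_mat')
  qed
  have carr: "M11 m t \<in> carrier_mat ?n (m 2 * m 3)" "M31 m \<in> carrier_mat ?n (m 2 * m 3)"
    "M21 m \<in> carrier_mat (m 2 * m 3) ?n" "M41 m t \<in> carrier_mat (m 2 * m 3) ?n"
    "M12 m t \<in> carrier_mat ?n (m 1 * m 3)" "M32 m \<in> carrier_mat ?n (m 1 * m 3)"
    "M22 m \<in> carrier_mat (m 1 * m 3) ?n" "M42 m t \<in> carrier_mat (m 1 * m 3) ?n"
    "K11 m t \<in> carrier_mat (m 1 * m 3) (m 2 * m 3)" "K12 m t \<in> carrier_mat (m 2 * m 3) (m 1 * m 3)"
    "L_part m 1 * mat_adjoint (L_part m 2) \<in> carrier_mat (m 1 * m 3) (m 2 * m 3)"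
    by (auto intro!: carrier_matI simp: M11_def M31_kron M21_kron M41_def M12_def M32_kron M22_kron
        M42_def K11_def K12_def L_part_def)
  have u: "u_fun m t p \<mu> = - (q_fun m \<mu> \<cdot>\<^sub>m (U_mat m 3 * (u_hat_fun m t p \<mu>)\<^sup>T * U_tilde m k))"
    if kp: "p = 1 \<and> k = 2 \<or> p = 2 \<and> k = 1"
      and \<mu>: "\<mu> 1 \<noteq> \<i>/2" "\<mu> 2 \<noteq> \<i>/2" "\<mu> 1 \<noteq> - \<i>/2" "\<mu> 2 \<noteq> - \<i>/2" for k p \<mu>
  proof -
    let ?X = "q_fun m \<mu> \<cdot>\<^sub>m antitr (W_mat m \<mu>)" and ?d = "m k * m 3"
    let ?y = "w_col m \<mu> k \<otimes>\<^sub>K 1\<^sub>m (m 3)" and ?zk = "cayley_pow m \<mu> k"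
    have k: "3 - p = k" using kp by auto
    have \<mu>k: "\<mu> k \<noteq> \<i>/2" "\<mu> k \<noteq> - \<i>/2" using kp \<mu> by auto
    note [simp] = w_col_carrier[of \<mu>, OF \<mu>(1)] w_col_carrier[of \<mu>, OF \<mu>(2)]
      w_col_carrier[of \<mu>, OF \<mu>k(1)]
    have W: "W_mat m \<mu> \<in> carrier_mat ?n (m 3)" by (rule carrier_matI) (simp_all add: W_mat_def mult.assoc del: One_nat_def)
    have y: "?y \<in> carrier_mat ?d (m 3)" by (rule carrier_matI) (simp_all del: One_nat_def)
    have u1: "u_fun m t p \<mu> = ?X * (R * Pi_mat m t p) -
        \<i> \<cdot>\<^sub>m ((?zk \<cdot>\<^sub>m antitr ?y) * (1\<^sub>m ?d @\<^sub>c 0\<^sub>m ?d ?d))"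
      unfolding u_fun_def v_fun_def Let_def k L_mat_adjoint_resolvents[of \<mu>, OF \<mu>] mat_adjoint_ones
        ones_resolvent_w_col[of \<mu>, OF \<mu>k] Gamma_mat_def R_def kron_smult_left
      by (simp add: antitr_kron)
    have [simp]: "dim_col (Pi_hat m t p) = ?n" "dim_row R = ?n" "dim_col R = ?n"
      using kp carrier_matD[OF carr(3)] carrier_matD[OF carr(7)] R(1) by (auto simp: Pi_hat_def)
    have "Pi_hat m t p * R * (mat_inv (A_mat m 1 - \<mu> 1 \<cdot>\<^sub>m 1\<^sub>m (m 1 * m 2 * m 3)) *
       mat_inv (A_mat m 2 - \<mu> 2 \<cdot>\<^sub>m 1\<^sub>m (m 1 * m 2 * m 3))) * L_mat m = Pi_hat m t p * R * W_mat m \<mu>"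
      using carrier_matD[OF resolvents_L_mat(2)[of \<mu> m, OF \<mu>(1,2)]]
        resolvents_L_mat(1)[of \<mu> m, OF \<mu>(1,2)]
      by (subst mult_mat_assoc_dim) (simp_all add: L_mat_def mult.assoc)
    then have u2: "u_hat_fun m t p \<mu> = Pi_hat m t p * R * W_mat m \<mu> +
        \<i> \<cdot>\<^sub>m ((0\<^sub>m ?d ?d @\<^sub>r 1\<^sub>m ?d) * ?y)"
      unfolding u_hat_fun_def v_hat_fun_def Let_def k Gamma_hat_def R_def[symmetric]
        w_col_def[symmetric] by simp
    have q: "q_fun m \<mu> = cayley_pow m \<mu> p * cayley_pow m \<mu> k"
      using kp by (auto simp: q_fun_def cayley_pow_def)
    show ?thesis
      using kp
    proof
      assume kp: "p = 1 \<and> k = 2"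
      then have pk: "p = 1" "k = 2" by auto
      have Pi: "Pi_mat m t p = M11 m t @\<^sub>c M31 m" "Pi_hat m t p = M21 m @\<^sub>r M41 m t"
        by (simp_all add: pk Pi_mat_def Pi_hat_def)
      show ?thesis
        unfolding u1 u2 U_mat_exchange Pi unfolding pk
      proof (rule u_from_displacement[OF T R(1) carr(1,2,3,4) W y[unfolded pk] refl R(3) antitr_R
            M11_add_antitr_M41 antitr_M21 _ q[unfolded pk]])
        show "?X * M31 m = (\<i> * (1 - cayley_pow m \<mu> 1)) \<cdot>\<^sub>m
            (cayley_pow m \<mu> 2 \<cdot>\<^sub>m antitr (w_col m \<mu> 2 \<otimes>\<^sub>K 1\<^sub>m (m 3)))"
          by (rule W_mat_mult_M31[of \<mu>, OF \<mu>(1,2,3)])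
      qed
    next
      assume kp: "p = 2 \<and> k = 1"
      then have pk: "p = 2" "k = 1" by auto
      have Pi: "Pi_mat m t p = M12 m t @\<^sub>c M32 m" "Pi_hat m t p = M22 m @\<^sub>r M42 m t"
        by (simp_all add: pk Pi_mat_def Pi_hat_def)
      show ?thesis
        unfolding u1 u2 U_mat_exchange Pi unfolding pk
      proof (rule u_from_displacement[OF T R(1) carr(5,6,7,8) W y[unfolded pk] refl R(3) antitr_R
            M12_add_antitr_M42 antitr_M22 _ q[unfolded pk]])
        show "?X * M32 m = (\<i> * (1 - cayley_pow m \<mu> 2)) \<cdot>\<^sub>m
            (cayley_pow m \<mu> 1 \<cdot>\<^sub>m antitr (w_col m \<mu> 1 \<otimes>\<^sub>K 1\<^sub>m (m 3)))"
          by (rule W_mat_mult_M32[of \<mu>, OF \<mu>(1,2,4)])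
      qed
    qed
  qed
  have "G21 m t = U_tilde m 1 * (G12 m t)\<^sup>T * U_tilde m 2"
    unfolding G21_def G12_def Gamma_mat_def R_def[symmetric]
    using G_21_from_displacement[OF T R(1) carr R(3,2) antitr_R antitr_tbt_mat M11_add_antitr_M41 antitr_M21
      M12_add_antitr_M42 antitr_M22 K11_add_M22_mult_antitr_M41 M22_mult_M31]
    by (simp add: Pi_mat_def Pi_hat_def antitr_L_part_mult_adjoint del: One_nat_def)
  with u show ?thesis by auto
qed

end
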